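(* In the model described in the context, define for $P>0$, $x\ge0$ $$ \bar A(P,x)=\frac{A_+(P,x+\gamma)+A_-(P,-x-\gamma)}{2}\ge0. $$ Assume that, for each $P>0$, $\bar A(P,\cdot)$ is twice continuously differentiable, and that there exist $A_0$ and $c$ (possibly depending on $P$) such that $\partial_{xx}\bar A(P,x)\le A_0e^{cx}$ for all $x\ge0$. Then, as $\lambda\to\infty$ (with $P,\sigma,\gamma$ and the pool fixed), $$ \overline{\mathsf{ARB}}=\frac{\sigma^2P}{2}\times\frac{y^{*\prime}(Pe^{-\gamma})+e^{+\gamma}\,y^{*\prime}(Pe^{+\gamma})}{2}\times\mathsf{P}_{\mathsf{trade}}+o\big(\sqrt{\lambda^{-1}}\big). $$
   Context: Model. Fix $\sigma,\gamma>0$ and, for each $\lambda>0$, consider the following. The external price satisfies $dP_t/P_t=\mu\,dt+\sigma\,dB_t$ with $\mu=\frac12\sigma^2$, $P_0=P>0$, $B$ a standard Brownian motion. Arbitrageurs arrive at the arrival times $0<\tau_1<\tau_2<\cdots$ of a Poisson process $N_t$ of rate $\lambda$, independent of $B$. The mispricing process $z_t$ satisfies $dz_t=\sigma\,dB_t$ between arrivals and $z_{\tau_i}=\max(\min(z_{\tau_i^-},\gamma),-\gamma)$ at arrivals; $z_{0^-}$ is independent of $(B,N)$ and distributed according to the unique invariant distribution $\pi$: with $\eta=\sqrt{2\lambda}\gamma/\sigma$, $\pi$ is uniform on $[-\gamma,\gamma]$ with total mass $\eta/(1+\eta)$, and $z-\gamma$ given $z>\gamma$, and $-\gamma-z$ given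 $z<-\gamma$, are exponential with parameter $\sqrt{2\lambda}/\sigma$, each of these two regions having mass $\frac12\frac1{1+\eta}$. Set $\mathsf{P}_{\mathsf{trade}}=\frac{1}{1+\sqrt{2\lambda}\gamma/\sigma}$. Pool. $f:\mathbb{R}_+^2\to\mathbb{R}$ is a bonding function and $L\in\mathbb{R}$; $V(P)=\min\{Px+y:(x,y)\in\mathbb{R}^2_+,\ f(x,y)=L\}$. Assume: (i) an optimal solution $(x^*(P),y^*(P))$ exists for every $P\ge0$; (ii) $V$ is everywhere twice continuously differentiable; (iii) $\mathsf{E}[\int_0^t x^*(P_s)^2P_s^2\,ds]<\infty$ for all $t\ge0$. Primes denote derivatives in price. Arbitrage profits ($\mathbb{I}$ denotes an indicator): $A_+(P,z)=\big[P\{x^*(Pe^{-z})-x^*(Pe^{-\gamma})\}+e^{\gamma}\{y^*(Pe^{-z})-y^*(Pe^{-\gamma})\}\big]\mathbb{I}_{\{z>\gamma\}}$, $A_-(P,z)=\big[e^{\gamma}P\{x^*(Pe^{-z})-x^*(Pe^{\gamma})\}+\{y^*(Pe^{-z})-y^*(Pe^{\gamma})\}\big]\mathbb{I}_{\{z<-\gamma\}}$, $A=A_++A_-$, $\mathsf{ARB}_T=\sum_{i=1}^{N_T}A(P_{\tau_i},z_{\tau_i^-})$, and $\overline{\mathsf{ARB}}=\lim_{T\to0}\mathsf{E}[\mathsf{ARB}_T]/T$, which equals $\lambda\mathsf{E}_\pi[A(P,z)]$. *)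

theory Defs
  imports "HOL-Probability.Probability" "HOL-Library.Landau_Symbols"
begin

text \<open>Independence of two random variables through the sigma-algebras they generate; the
  constant \<open>indep_var\<close> is not applicable because it forces both variables to have the same type.\<close>

definition indep_rv ::
  "'a measure \<Rightarrow> 'b measure \<Rightarrow> ('a \<Rightarrow> 'b) \<Rightarrow> 'c measure \<Rightarrow> ('a \<Rightarrow> 'c) \<Rightarrow> bool" where
  "indep_rv M S X T Y \<longleftrightarrow>
     prob_space.indep_set M (sets (vimage_algebra (space M) X S))
                            (sets (vimage_algebra (space M) Y T))"

definition brownian_motion :: "'a measure \<Rightarrow> (real \<Rightarrow> 'a \<Rightarrow> real) \<Rightarrow> bool" where
  "brownian_motion M B \<longleftrightarrow>
     (\<forall>t\<ge>0. B t \<in> borel_measurable M) \<and>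
     (\<forall>\<omega>\<in>space M. B 0 \<omega> = 0 \<and> continuous_on {0..} (\<lambda>t. B t \<omega>)) \<and>
     (\<forall>s t. 0 \<le> s \<and> s < t \<longrightarrow>
        distributed M lborel (\<lambda>\<omega>. B t \<omega> - B s \<omega>) (normal_density 0 (sqrt (t - s)))) \<and>
     (\<forall>n (t :: nat \<Rightarrow> real). 0 \<le> t 0 \<and> (\<forall>i<n. t i \<le> t (Suc i)) \<longrightarrow>
        prob_space.indep_vars M (\<lambda>_. borel) (\<lambda>i \<omega>. B (t (Suc i)) \<omega> - B (t i) \<omega>) {..<n})"

text \<open>Arrival times of a Poisson process of rate \<open>lam\<close>, i.e. partial sums of i.i.d. exponential
  waiting times. The arrivals are \<open>\<tau> 1 < \<tau> 2 < \<dots>\<close>; \<open>\<tau> 0 = 0\<close> is only the time origin.\<close>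

definition poisson_arrivals :: "'a measure \<Rightarrow> real \<Rightarrow> (nat \<Rightarrow> 'a \<Rightarrow> real) \<Rightarrow> bool" where
  "poisson_arrivals M lam \<tau> \<longleftrightarrow>
     (\<forall>\<omega>\<in>space M. \<tau> 0 \<omega> = 0 \<and> strict_mono (\<lambda>i. \<tau> i \<omega>)) \<and>
     prob_space.indep_vars M (\<lambda>_. borel) (\<lambda>i \<omega>. \<tau> (Suc i) \<omega> - \<tau> i \<omega>) UNIV \<and>
     (\<forall>i. distributed M lborel (\<lambda>\<omega>. \<tau> (Suc i) \<omega> - \<tau> i \<omega>) (exponential_density lam))"

definition arrival_count :: "(nat \<Rightarrow> 'a \<Rightarrow> real) \<Rightarrow> real \<Rightarrow> 'a \<Rightarrow> nat" where
  "arrival_count \<tau> t \<omega> = card {i. 1 \<le> i \<and> \<tau> i \<omega> \<le> t}"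

text \<open>Lebesgue density of the invariant distribution \<open>\<pi>\<close> of the mispricing.\<close>

definition invariant_density :: "real \<Rightarrow> real \<Rightarrow> real \<Rightarrow> real \<Rightarrow> real" where
  "invariant_density \<sigma> \<gamma> lam z =
     (let k = sqrt (2 * lam) / \<sigma>; \<eta> = sqrt (2 * lam) * \<gamma> / \<sigma> in
      if z > \<gamma> then 1 / 2 * (1 / (1 + \<eta>)) * exponential_density k (z - \<gamma>)
      else if z < - \<gamma> then 1 / 2 * (1 / (1 + \<eta>)) * exponential_density k (- \<gamma> - z)
      else \<eta> / (1 + \<eta>) * (1 / (2 * \<gamma>)))"

definition left_lim :: "(real \<Rightarrow> real) \<Rightarrow> real \<Rightarrow> real" where
  "left_lim g t = Lim (at_left t) g"

text \<open>A path of the mispricing: \<open>dz = \<sigma> dB\<close> between arrivals, projection onto \<open>[-\<gamma>, \<gamma>]\<close> at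
  arrivals. As \<open>\<tau> 1 > 0\<close>, there is no arrival at time 0, so the value at 0 is the initial value
  \<open>z\<^sub>0\<close> (the value at \<open>0-\<close>).\<close>

definition mispricing_path ::
  "real \<Rightarrow> real \<Rightarrow> (real \<Rightarrow> real) \<Rightarrow> (nat \<Rightarrow> real) \<Rightarrow> real \<Rightarrow> (real \<Rightarrow> real) \<Rightarrow> bool" where
  "mispricing_path \<sigma> \<gamma> b t z\<^sub>0 z \<longleftrightarrow>
     z 0 = z\<^sub>0 \<and>
     (\<forall>r s. 0 \<le> r \<and> r \<le> s \<and> (\<forall>i\<ge>1. t i \<notin> {r<..s}) \<longrightarrow> z s - z r = \<sigma> * (b s - b r)) \<and>
     (\<forall>i\<ge>1. z (t i) = max (min (left_lim z (t i)) \<gamma>) (- \<gamma>))"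

locale mispricing_model = prob_space M for M :: "'a measure" +
  fixes \<sigma> \<gamma> lam :: real
    and B :: "real \<Rightarrow> 'a \<Rightarrow> real"
    and \<tau> :: "nat \<Rightarrow> 'a \<Rightarrow> real"
    and z\<^sub>0 :: "'a \<Rightarrow> real"
    and z :: "real \<Rightarrow> 'a \<Rightarrow> real"
  assumes brownian: "brownian_motion M B"
    and poisson: "poisson_arrivals M lam \<tau>"
    and initial: "distributed M lborel z\<^sub>0 (invariant_density \<sigma> \<gamma> lam)"
    and indep_B_arrivals:
      "indep_rv M (\<Pi>\<^sub>M t\<in>{0..}. borel) (\<lambda>\<omega>. \<lambda>t\<in>{0..}. B t \<omega>)
                  (\<Pi>\<^sub>M i\<in>UNIV. borel) (\<lambda>\<omega> i. \<tau> i \<omega>)"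
    and indep_initial:
      "indep_rv M borel z\<^sub>0
                  ((\<Pi>\<^sub>M t\<in>{0..}. borel) \<Otimes>\<^sub>M (\<Pi>\<^sub>M i\<in>UNIV. borel))
                  (\<lambda>\<omega>. (\<lambda>t\<in>{0..}. B t \<omega>, \<lambda>i. \<tau> i \<omega>))"
    and mispricing:
      "\<And>\<omega>. \<omega> \<in> space M \<Longrightarrow>
         mispricing_path \<sigma> \<gamma> (\<lambda>t. B t \<omega>) (\<lambda>i. \<tau> i \<omega>) (z\<^sub>0 \<omega>) (\<lambda>t. z t \<omega>)"

text \<open>Solution of \<open>dP/P = \<mu> dt + \<sigma> dB\<close> started at \<open>P\<close>, for the drift \<open>\<mu> = \<sigma>\<^sup>2 / 2\<close>.\<close>

definition price :: "real \<Rightarrow> real \<Rightarrow> (real \<Rightarrow> 'a \<Rightarrow> real) \<Rightarrow> real \<Rightarrow> 'a \<Rightarrow> real" where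
  "price \<sigma> P B t \<omega> =
     (let \<mu> = \<sigma>\<^sup>2 / 2 in P * exp ((\<mu> - \<sigma>\<^sup>2 / 2) * t + \<sigma> * B t \<omega>))"

definition P_trade :: "real \<Rightarrow> real \<Rightarrow> real \<Rightarrow> real" where
  "P_trade \<sigma> \<gamma> lam = 1 / (1 + sqrt (2 * lam) * \<gamma> / \<sigma>)"

definition reserves :: "(real \<times> real \<Rightarrow> real) \<Rightarrow> real \<Rightarrow> (real \<times> real) set" where
  "reserves f L = {(x, y). 0 \<le> x \<and> 0 \<le> y \<and> f (x, y) = L}"

definition optimal_reserves :: "(real \<times> real \<Rightarrow> real) \<Rightarrow> real \<Rightarrow> real \<Rightarrow> real \<times> real \<Rightarrow> bool" where
  "optimal_reserves f L P = is_arg_min (\<lambda>(x, y). P * x + y) (\<lambda>q. q \<in> reserves f L)"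

text \<open>The infimum is a minimum as soon as optimal reserves exist.\<close>

definition pool_value :: "(real \<times> real \<Rightarrow> real) \<Rightarrow> real \<Rightarrow> real \<Rightarrow> real" where
  "pool_value f L P = (INF (x, y)\<in>reserves f L. P * x + y)"

text \<open>\<open>g\<close> is twice continuously differentiable on \<open>S\<close> with derivatives \<open>g1\<close> and \<open>g2\<close>
  (one-sided at boundary points of an interval \<open>S\<close>).\<close>

definition C2_derivs ::
  "real set \<Rightarrow> (real \<Rightarrow> real) \<Rightarrow> (real \<Rightarrow> real) \<Rightarrow> (real \<Rightarrow> real) \<Rightarrow> bool" where
  "C2_derivs S g g1 g2 \<longleftrightarrow>
     (\<forall>x\<in>S. (g has_real_derivative g1 x) (at x within S)) \<and>
     (\<forall>x\<in>S. (g1 has_real_derivative g2 x) (at x within S)) \<and>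
     continuous_on S g2"

definition A_plus ::
  "real \<Rightarrow> (real \<Rightarrow> real) \<Rightarrow> (real \<Rightarrow> real) \<Rightarrow> real \<Rightarrow> real \<Rightarrow> real" where
  "A_plus \<gamma> xs ys P z =
     (P * (xs (P * exp (- z)) - xs (P * exp (- \<gamma>)))
       + exp \<gamma> * (ys (P * exp (- z)) - ys (P * exp (- \<gamma>)))) * indicator {\<gamma><..} z"

definition A_minus ::
  "real \<Rightarrow> (real \<Rightarrow> real) \<Rightarrow> (real \<Rightarrow> real) \<Rightarrow> real \<Rightarrow> real \<Rightarrow> real" where
  "A_minus \<gamma> xs ys P z =
     (exp \<gamma> * P * (xs (P * exp (- z)) - xs (P * exp \<gamma>))
       + (ys (P * exp (- z)) - ys (P * exp \<gamma>))) * indicator {..<- \<gamma>} z"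

definition A_total ::
  "real \<Rightarrow> (real \<Rightarrow> real) \<Rightarrow> (real \<Rightarrow> real) \<Rightarrow> real \<Rightarrow> real \<Rightarrow> real" where
  "A_total \<gamma> xs ys P z = A_plus \<gamma> xs ys P z + A_minus \<gamma> xs ys P z"

definition A_bar ::
  "real \<Rightarrow> (real \<Rightarrow> real) \<Rightarrow> (real \<Rightarrow> real) \<Rightarrow> real \<Rightarrow> real \<Rightarrow> real" where
  "A_bar \<gamma> xs ys P x = (A_plus \<gamma> xs ys P (x + \<gamma>) + A_minus \<gamma> xs ys P (- x - \<gamma>)) / 2"

definition ARB ::
  "real \<Rightarrow> real \<Rightarrow> (real \<Rightarrow> real) \<Rightarrow> (real \<Rightarrow> real) \<Rightarrow> real \<Rightarrow> (real \<Rightarrow> 'a \<Rightarrow> real) \<Rightarrow>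
   (nat \<Rightarrow> 'a \<Rightarrow> real) \<Rightarrow> (real \<Rightarrow> 'a \<Rightarrow> real) \<Rightarrow> real \<Rightarrow> 'a \<Rightarrow> real" where
  "ARB \<sigma> \<gamma> xs ys P B \<tau> z T \<omega> =
     (\<Sum>i = 1..arrival_count \<tau> T \<omega>.
        A_total \<gamma> xs ys (price \<sigma> P B (\<tau> i \<omega>) \<omega>) (left_lim (\<lambda>t. z t \<omega>) (\<tau> i \<omega>)))"

definition ARB_rate ::
  "'a measure \<Rightarrow> real \<Rightarrow> real \<Rightarrow> (real \<Rightarrow> real) \<Rightarrow> (real \<Rightarrow> real) \<Rightarrow> real \<Rightarrow>
   (real \<Rightarrow> 'a \<Rightarrow> real) \<Rightarrow> (nat \<Rightarrow> 'a \<Rightarrow> real) \<Rightarrow> (real \<Rightarrow> 'a \<Rightarrow> real) \<Rightarrow> real" where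
  "ARB_rate M \<sigma> \<gamma> xs ys P B \<tau> z =
     Lim (at_right 0) (\<lambda>T. integral\<^sup>L M (ARB \<sigma> \<gamma> xs ys P B \<tau> z T) / T)"

end

theory Submission
  imports Defs "HOL-Real_Asymp.Real_Asymp"
begin

text \<open>The expected profit over \<open>[0, T]\<close> is dominated by the first arrival: the pool price is
  frozen between arrivals and the optimal risky holdings are bounded by those at price \<open>0\<close>, so the
  profit at an arrival is at most linear in the external prices at that arrival and at the previous
  one, and all later arrivals together contribute \<open>O(T\<^sup>2)\<close>. The first arrival time is independent of
  the initial mispricing and the Brownian motion, so the rate is \<open>\<lambda>\<close> times the profit at time \<open>0\<close>
  averaged over \<open>\<pi>\<close>. As \<open>\<pi>\<close> has exponential tails of rate \<open>k = sqrt (2\<lambda>) / \<sigma>\<close> outside the band,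
  this average is \<open>P_trade\<close> times the Laplace-type integral of \<open>k exp (- k x)\<close> against \<open>A_bar\<close>.
  Now \<open>A_bar\<close> vanishes to second order at \<open>0\<close>, with second derivative given by the one of the pool
  value at the two edges of the band, and grows at most exponentially, so that integral times \<open>k\<^sup>2\<close>
  tends to this second derivative.\<close>

section \<open>Pools\<close>

text \<open>Profits are nonnegative, so expectations are handled as integrals in
  \<open>ennreal\<close>: sums and iterated integrals are exchanged freely, and finiteness comes out
  of the bounds instead of being required beforehand. Three points shape the argument. The Brownian
  motion is sampled at random times, which independence allows to be frozen; this needs a jointly
  measurable substitute for path evaluation. The initial mispricing has only exponential tails, of
  rate \<open>k\<close>, so the initial pool price \<open>P * exp (- z\<^sub>0)\<close> has a finite
  mean only for \<open>k > 1\<close>, and the Laplace integrands get a common majorant for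
  \<open>k \<ge> 2\<close>; both hold once \<lambda> is large, which explains the thresholds 1 and
  2. Finally \<open>lam = \<sigma>\<^sup>2 * k\<^sup>2 / 2\<close>: the arrival rate itself supplies
  the factor \<open>k\<^sup>2\<close> that the Laplace integral needs, and
  \<open>\<sigma>\<^sup>2 / 2\<close> is left over as the constant of the theorem. As
  \<open>P_trade\<close> is of order 1 / sqrt \<lambda>, convergence of the Laplace factor suffices,
  without any rate.\<close>

locale smooth_pool =
  fixes f :: "real \<times> real \<Rightarrow> real" and L :: real
    and xs ys V1 V2 :: "real \<Rightarrow> real"
  assumes optimal: "\<And>p. p \<ge> 0 \<Longrightarrow> optimal_reserves f L p (xs p, ys p)"
    and C2_value: "C2_derivs {0<..} (pool_value f L) V1 V2"
begin

lemma reserves_nonneg: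
  assumes "p \<ge> 0"
  shows "0 \<le> xs p" "0 \<le> ys p"
  using optimal[OF assms] by (auto simp: optimal_reserves_def is_arg_min_def reserves_def)

lemma optimal_le:
  assumes "p \<ge> 0" "q \<ge> 0"
  shows "p * xs p + ys p \<le> p * xs q + ys q"
proof -
  have "(xs q, ys q) \<in> reserves f L"
    using optimal[OF assms(2)] by (auto simp: optimal_reserves_def is_arg_min_def)
  then show ?thesis
    using optimal[OF assms(1)] by (force simp: optimal_reserves_def is_arg_min_def)
qed

lemma pool_value_eq:
  assumes "p \<ge> 0"
  shows "pool_value f L p = p * xs p + ys p"
  unfolding pool_value_def
proof (rule cInf_eq_minimum)
  have "(xs p, ys p) \<in> reserves f L"
    using optimal[OF assms] by (auto simp: optimal_reserves_def is_arg_min_def)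
  then show "p * xs p + ys p \<in> (\<lambda>(x, y). p * x + y) ` reserves f L"
    by (force intro: image_eqI[of _ _ "(xs p, ys p)"])
next
  fix v assume "v \<in> (\<lambda>(x, y). p * x + y) ` reserves f L"
  then show "p * xs p + ys p \<le> v"
    using optimal[OF assms] by (force simp: optimal_reserves_def is_arg_min_def not_less)
qed

text \<open>The loss, at price \<open>p\<close>, from holding the reserves that are optimal at
  \<open>q\<close>. For positive prices it is the Bregman divergence V(q) + (p - q) V'(q) - V(p) of
  the concave value function V.\<close>

definition excess :: "real \<Rightarrow> real \<Rightarrow> real" where
  "excess p q = p * (xs q - xs p) + (ys q - ys p)"

lemma excess_nonneg: "p \<ge> 0 \<Longrightarrow> q \<ge> 0 \<Longrightarrow> 0 \<le> excess p q"
  using optimal_le[of p q] by (simp add: excess_def algebra_simps)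

lemma excess_self [simp]: "excess p p = 0"
  by (simp add: excess_def)

text \<open>The existence of optimal reserves at price \<open>0\<close> is what bounds the risky holdings.\<close>

lemma xs_le_xs_0:
  assumes "p > 0"
  shows "xs p \<le> xs 0"
proof -
  have "p * xs p \<le> p * xs 0"
    using optimal_le[of p 0] optimal_le[of 0 p] assms by linarith
  then show ?thesis using assms by simp
qed

text \<open>Optimality at \<open>q\<close> trades the cash difference for a difference of risky
  holdings at price \<open>q\<close>. Only risky holdings remain, and these lie between 0 and
  \<open>xs 0\<close>.\<close>

lemma excess_le:
  assumes "p > 0" "q > 0"
  shows "excess p q \<le> (p + q) * xs 0"
proof -
  have "ys q - ys p \<le> q * xs p - q * xs q"
    using optimal_le[of q p] assms by simp
  also have "\<dots> \<le> q * xs 0 - 0"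
    using assms reserves_nonneg[of q] xs_le_xs_0[of p]
    by (intro diff_mono mult_left_mono) auto
  finally have "ys q - ys p \<le> q * xs 0" by simp
  moreover have "p * (xs q - xs p) \<le> p * xs 0"
    using assms reserves_nonneg[of p] xs_le_xs_0[of q] by (intro mult_left_mono) auto
  ultimately show ?thesis by (simp add: excess_def algebra_simps)
qed

section \<open>Optimal reserves and the derivatives of the pool value\<close>

lemma value_DERIV:
  assumes "p > 0"
  shows "(pool_value f L has_real_derivative V1 p) (at p)"
    and "(V1 has_real_derivative V2 p) (at p)"
  using C2_value assms by (auto simp: C2_derivs_def at_within_open[OF _ open_greaterThan])

text \<open>The line \<open>q \<mapsto> q x\<^sup>*(p) + y\<^sup>*(p)\<close> touches the value function from above at \<open>p\<close>.\<close>

lemma xs_eq: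
  assumes "p > 0"
  shows "xs p = V1 p"
proof -
  let ?h = "\<lambda>q. pool_value f L q - (q * xs p + ys p)"
  have "(?h has_real_derivative V1 p - xs p) (at p)"
    by (auto intro!: derivative_eq_intros value_DERIV assms)
  \<comment> \<open>The radius \<open>p\<close> keeps \<open>q\<close> positive, so that reserves
    optimal at \<open>q\<close> exist.\<close>
  moreover have "\<forall>q. \<bar>p - q\<bar> < p \<longrightarrow> ?h q \<le> ?h p"
    using optimal_le[of _ p] assms by (auto simp: pool_value_eq)
  ultimately have "V1 p - xs p = 0"
    using assms by (intro DERIV_local_max[of ?h _ p p]) auto
  then show ?thesis by simp
qed

lemma ys_eq: "p > 0 \<Longrightarrow> ys p = pool_value f L p - p * V1 p"
  using pool_value_eq[of p] by (simp add: xs_eq)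

lemma xs_DERIV:
  assumes "p > 0"
  shows "(xs has_real_derivative V2 p) (at p)"
  by (rule has_field_derivative_transform_within_open[OF value_DERIV(2)[OF assms], of "{0<..}"])
    (use assms in \<open>auto simp: xs_eq\<close>)

text \<open>The terms with \<open>V1\<close> cancel in the product rule. What remains is the
  envelope relation ys'(p) = - p xs'(p).\<close>

lemma ys_DERIV:
  assumes "p > 0"
  shows "(ys has_real_derivative - p * V2 p) (at p)"
proof -
  have "((\<lambda>p. pool_value f L p - p * V1 p) has_real_derivative - p * V2 p) (at p)"
    by (auto intro!: derivative_eq_intros value_DERIV assms)
  then show ?thesis
    by (rule has_field_derivative_transform_within_open[where S = "{0<..}"])
      (use assms in \<open>auto simp: ys_eq\<close>)
qed

lemma deriv_ys: "p > 0 \<Longrightarrow> deriv ys p = - p * V2 p"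
  by (rule DERIV_imp_deriv) (rule ys_DERIV)

lemma continuous_on_reserves:
  "continuous_on {0<..} xs" "continuous_on {0<..} ys"
  using xs_DERIV ys_DERIV by (auto intro!: continuous_at_imp_continuous_on DERIV_isCont)

text \<open>By the envelope relation the derivative of \<open>excess p q\<close> in \<open>q\<close>
  is \<open>(p - q) * V2 q\<close>, which contains the factor \<open>q - p\<close> explicitly. Hence
  a single use of l'Hopital is enough, and continuity of \<open>V2\<close> at \<open>p\<close> gives
  the limit.\<close>

lemma excess_over_square:
  assumes "p > 0"
  shows "((\<lambda>q. excess p q / (q - p)\<^sup>2) \<longlongrightarrow> - V2 p / 2) (at p)"
proof (rule lhopital)
  have ev: "eventually (\<lambda>q. q > 0) (at p)"
    using assms eventually_at_in_open'[of "{0<..}" p] by (simp)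
  have "continuous_on {0<..} V2" using C2_value by (simp add: C2_derivs_def)
  then have cV2: "(V2 \<longlongrightarrow> V2 p) (at p)"
    using assms by (auto simp: continuous_on_def at_within_open[OF _ open_greaterThan])
  have "isCont xs p" "isCont ys p" using xs_DERIV ys_DERIV assms DERIV_isCont by blast+
  then have "(xs \<longlongrightarrow> xs p) (at p)" "(ys \<longlongrightarrow> ys p) (at p)" by (auto simp: isCont_def)
  then show "(excess p \<longlongrightarrow> 0) (at p)"
    unfolding excess_def by (auto intro!: tendsto_eq_intros)
  show "((\<lambda>q. (q - p)\<^sup>2) \<longlongrightarrow> 0) (at p)" by (auto intro!: tendsto_eq_intros)
  show "eventually (\<lambda>q. (q - p)\<^sup>2 \<noteq> 0) (at p)" "eventually (\<lambda>q. 2 * (q - p) \<noteq> 0) (at p)"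
    by (auto simp: eventually_at_filter)
  show "eventually (\<lambda>q. (excess p has_real_derivative (p - q) * V2 q) (at q)) (at p)"
    using ev by eventually_elim
      (auto simp: excess_def [abs_def] algebra_simps intro!: derivative_eq_intros xs_DERIV ys_DERIV)
  show "eventually (\<lambda>q. ((\<lambda>q. (q - p)\<^sup>2) has_real_derivative 2 * (q - p)) (at q)) (at p)"
    by (auto intro!: always_eventually derivative_eq_intros)
  have "((\<lambda>q. - V2 q / 2) \<longlongrightarrow> - V2 p / 2) (at p)" by (intro tendsto_intros cV2) auto
  then show "((\<lambda>q. (p - q) * V2 q / (2 * (q - p))) \<longlongrightarrow> - V2 p / 2) (at p)"
    by (rule Lim_transform_eventually) (auto simp: eventually_at_filter field_simps)
qed

text \<open>Change of variable from price to log price: \<open>p * exp (s * x) - p\<close> behaves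
  like \<open>s * p * x\<close>, and its square does not see the sign \<open>s\<close>. Both signs
  are needed because a trade pushes away from the band downwards at one edge and upwards at the
  other.\<close>

lemma excess_exp_over_square:
  assumes "p > 0" "s = 1 \<or> s = -1"
  shows "((\<lambda>x. excess p (p * exp (s * x)) / x\<^sup>2) \<longlongrightarrow> p * deriv ys p / 2) (at_right 0)"
proof -
  have "filterlim (\<lambda>x. p * exp (s * x)) (at p) (at_right 0)"
    using assms(1,2) by (auto simp: filterlim_at eventually_at_filter intro!: tendsto_eq_intros)
  from filterlim_compose[OF excess_over_square[OF assms(1)] this]
  have "((\<lambda>x. excess p (p * exp (s * x)) / (p * exp (s * x) - p)\<^sup>2) \<longlongrightarrow> - V2 p / 2) (at_right 0)" .
  moreover have "((\<lambda>x. ((p * exp (s * x) - p) / x)\<^sup>2) \<longlongrightarrow> p\<^sup>2) (at_right 0)"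
  proof -
    have "((\<lambda>x. ((p * exp x - p) / x)\<^sup>2) \<longlongrightarrow> p\<^sup>2) (at_right 0)"
      "((\<lambda>x. ((p * exp (- x) - p) / x)\<^sup>2) \<longlongrightarrow> p\<^sup>2) (at_right 0)"
      using assms(1) by (real_asymp simp: power2_eq_square)+
    then show ?thesis using assms(2) by auto
  qed
  ultimately have lim: "((\<lambda>x. excess p (p * exp (s * x)) / (p * exp (s * x) - p)\<^sup>2 *
      ((p * exp (s * x) - p) / x)\<^sup>2) \<longlongrightarrow> - V2 p / 2 * p\<^sup>2) (at_right 0)"
    by (rule tendsto_mult)
  have eq: "- V2 p / 2 * p\<^sup>2 = p * deriv ys p / 2"
    using assms(1) by (simp add: deriv_ys power2_eq_square)
  have "eventually (\<lambda>x. excess p (p * exp (s * x)) / (p * exp (s * x) - p)\<^sup>2 *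
      ((p * exp (s * x) - p) / x)\<^sup>2 = excess p (p * exp (s * x)) / x\<^sup>2) (at_right 0)"
    using assms by (auto simp: eventually_at_filter power_divide)
  with lim show ?thesis unfolding eq by (rule Lim_transform_eventually)
qed

section \<open>Arbitrage profits as excesses\<close>

lemma A_plus_eq:
  "A_plus \<gamma> xs ys P z = exp \<gamma> * excess (P * exp (- \<gamma>)) (P * exp (- max z \<gamma>))"
proof -
  have "exp \<gamma> * excess (P * exp (- \<gamma>)) q = P * (xs q - xs (P * exp (- \<gamma>))) + exp \<gamma> * (ys q - ys (P * exp (- \<gamma>)))" for q
    by (simp add: excess_def distrib_left exp_minus)
  \<comment> \<open>Clipping by \<open>max z \<gamma>\<close> absorbs the indicator: for
    \<open>z \<le> \<gamma>\<close> both prices agree and the excess is 0.\<close>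
  then show ?thesis by (auto simp: A_plus_def max_def indicator_def)
qed

lemma A_minus_eq:
  "A_minus \<gamma> xs ys P z = excess (P * exp \<gamma>) (P * exp (- min z (- \<gamma>)))"
  by (auto simp: A_minus_def excess_def min_def algebra_simps indicator_def)

lemma A_nonneg:
  assumes "P > 0"
  shows "A_plus \<gamma> xs ys P z \<ge> 0" "A_minus \<gamma> xs ys P z \<ge> 0" "A_total \<gamma> xs ys P z \<ge> 0"
    and "A_bar \<gamma> xs ys P x \<ge> 0"
  using assms by (auto simp: A_total_def A_bar_def A_plus_eq A_minus_eq
      intro!: excess_nonneg add_nonneg_nonneg mult_nonneg_nonneg)

text \<open>The 2 accounts for the two sides of the band; \<open>exp \<gamma>\<close> bounds the fee
  factor of either side.\<close>

definition A_const :: "real \<Rightarrow> real" where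
  "A_const \<gamma> = 2 * exp \<gamma> * xs 0"

lemma A_const_nonneg: "A_const \<gamma> \<ge> 0"
  by (simp add: A_const_def reserves_nonneg)

text \<open>\<open>P * exp (- z)\<close> is the pool price before the trade. The bound is linear in
  it and in the external price because \<open>excess_le\<close> is linear in its two prices.\<close>

lemma A_total_le:
  assumes "P > 0" "\<gamma> \<ge> 0"
  shows "A_total \<gamma> xs ys P z \<le> A_const \<gamma> * (P + P * exp (- z))"
proof -
  have x0: "xs 0 \<ge> 0" by (simp add: reserves_nonneg)
  have "A_plus \<gamma> xs ys P z \<le> exp \<gamma> * (xs 0 * (P + P * exp (- z)))"
  proof -
    have "excess (P * exp (- \<gamma>)) (P * exp (- max z \<gamma>))
        \<le> (P * exp (- \<gamma>) + P * exp (- max z \<gamma>)) * xs 0"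
      using assms by (intro excess_le) auto
    also have "\<dots> \<le> (P + P * exp (- z)) * xs 0"
      using assms x0 by (intro mult_right_mono add_mono) auto
    finally show ?thesis by (simp add: A_plus_eq mult.commute)
  qed
  moreover have "A_minus \<gamma> xs ys P z \<le> exp \<gamma> * (xs 0 * (P + P * exp (- z)))"
  proof (cases "z < - \<gamma>")
    case True
    then have "A_minus \<gamma> xs ys P z = excess (P * exp \<gamma>) (P * exp (- z))"
      by (simp add: A_minus_eq)
    also have "\<dots> \<le> (P * exp \<gamma> + P * exp (- z)) * xs 0"
      using assms by (intro excess_le) auto
    also have "\<dots> \<le> (P * exp \<gamma> + exp \<gamma> * (P * exp (- z))) * xs 0"
      using assms x0 mult_right_mono[of 1 "exp \<gamma>" "P * exp (- z)"]
      by (intro mult_right_mono add_mono order_refl) auto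
    finally show ?thesis by (simp add: algebra_simps)
  next
    case False
    then show ?thesis using assms x0 by (simp add: A_minus_def)
  qed
  ultimately show ?thesis by (simp add: A_total_def A_const_def algebra_simps)
qed

text \<open>The clipped forms are continuous across the edges of the band. Writing the price as
  \<open>P * exp (a x)\<close> keeps it in the open half-line on which the reserves are
  continuous.\<close>

lemma continuous_on_A_total:
  assumes "P > 0" "continuous_on S a" "continuous_on S b"
  shows "continuous_on S (\<lambda>x. A_total \<gamma> xs ys (P * exp (a x)) (b x))"
  unfolding A_total_def A_plus_eq A_minus_eq excess_def
  by (intro continuous_intros continuous_on_compose2[OF continuous_on_reserves(1)]
      continuous_on_compose2[OF continuous_on_reserves(2)] assms) (use assms in auto)

lemma A_total_measurable:
  assumes "P > 0" and [measurable]: "a \<in> borel_measurable N" "b \<in> borel_measurable N"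
  shows "(\<lambda>x. A_total \<gamma> xs ys (P * exp (a x)) (b x)) \<in> borel_measurable N"
proof -
  have "(\<lambda>u :: real \<times> real. A_total \<gamma> xs ys (P * exp (fst u)) (snd u)) \<in> borel_measurable borel"
    by (intro borel_measurable_continuous_onI continuous_on_A_total continuous_intros assms)
  then have "(\<lambda>u :: real \<times> real. A_total \<gamma> xs ys (P * exp (fst u)) (snd u))
      \<in> borel_measurable (borel \<Otimes>\<^sub>M borel)"
    by (simp add: borel_prod)
  from measurable_compose[OF _ this, of "\<lambda>x. (a x, b x)" N] show ?thesis by simp
qed

lemma A_total_measurable_mispricing:
  assumes "P > 0"
  shows "A_total \<gamma> xs ys P \<in> borel_measurable borel"
proof -
  have "(\<lambda>x. A_total \<gamma> xs ys (P * exp 0) x) \<in> borel_measurable borel"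
    by (rule A_total_measurable[OF assms]) simp_all
  then show ?thesis unfolding exp_zero mult_1_right .
qed

lemma A_bar_eq:
  assumes "x \<ge> 0"
  shows "A_bar \<gamma> xs ys P x
    = (exp \<gamma> * excess (P * exp (- \<gamma>)) (P * exp (- \<gamma>) * exp (- x))
       + excess (P * exp \<gamma>) (P * exp \<gamma> * exp x)) / 2"
  using assms by (simp add: A_bar_def A_plus_eq A_minus_eq exp_minus exp_add field_simps exp_diff)

lemma A_total_eq_A_bar:
  assumes "x > 0" "\<gamma> \<ge> 0"
  shows "A_total \<gamma> xs ys P (x + \<gamma>) + A_total \<gamma> xs ys P (- x - \<gamma>) = 2 * A_bar \<gamma> xs ys P x"
  using assms by (simp add: A_bar_def A_total_def A_plus_def A_minus_def)

text \<open>Twice the quadratic coefficient of \<open>A_bar\<close> at 0. Multiplied by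
  \<open>\<sigma>\<^sup>2 / 2\<close> it is the coefficient of \<open>P_trade\<close> in the
  theorem.\<close>

definition A_curv :: "real \<Rightarrow> real \<Rightarrow> real" where
  "A_curv \<gamma> P = P * ((deriv ys (P * exp (- \<gamma>)) + exp \<gamma> * deriv ys (P * exp \<gamma>)) / 2)"

text \<open>At the edge price \<open>P * exp (- \<gamma>)\<close> the fee factor
  \<open>exp \<gamma>\<close> cancels the edge factor; at \<open>P * exp \<gamma>\<close> the edge
  factor survives. This is the asymmetry between the two terms of \<open>A_curv\<close>.\<close>

lemma A_bar_over_square:
  assumes "P > 0"
  shows "((\<lambda>x. A_bar \<gamma> xs ys P x / x\<^sup>2) \<longlongrightarrow> A_curv \<gamma> P / 2) (at_right 0)"
proof -
  have "((\<lambda>x. (exp \<gamma> * (excess (P * exp (- \<gamma>)) (P * exp (- \<gamma>) * exp ((-1) * x)) / x\<^sup>2)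
       + excess (P * exp \<gamma>) (P * exp \<gamma> * exp (1 * x)) / x\<^sup>2) / 2)
      \<longlongrightarrow> (exp \<gamma> * (P * exp (- \<gamma>) * deriv ys (P * exp (- \<gamma>)) / 2)
          + P * exp \<gamma> * deriv ys (P * exp \<gamma>) / 2) / 2) (at_right 0)"
    using assms by (intro tendsto_intros excess_exp_over_square) auto
  also have "(exp \<gamma> * (P * exp (- \<gamma>) * deriv ys (P * exp (- \<gamma>)) / 2)
          + P * exp \<gamma> * deriv ys (P * exp \<gamma>) / 2) / 2 = A_curv \<gamma> P / 2"
    by (simp add: A_curv_def field_simps exp_minus)
  finally show ?thesis
    by (rule Lim_transform_eventually)
      (auto simp: eventually_at_filter A_bar_eq add_divide_distrib)
qed

lemma A_bar_measurable:
  assumes "P > 0"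
  shows "A_bar \<gamma> xs ys P \<in> borel_measurable borel"
proof -
  have "(\<lambda>z. A_plus \<gamma> xs ys P z) \<in> borel_measurable borel"
    "(\<lambda>z. A_minus \<gamma> xs ys P z) \<in> borel_measurable borel"
    unfolding A_plus_eq A_minus_eq excess_def
    by (intro borel_measurable_continuous_onI continuous_intros
      continuous_on_compose2[OF continuous_on_reserves(1)]
      continuous_on_compose2[OF continuous_on_reserves(2)]; use assms in auto)+
  note [measurable] = this
  show ?thesis unfolding A_bar_def[abs_def] by measurable
qed

text \<open>Two bounds are glued at some \<open>d\<close>: below \<open>d\<close> the quadratic
  limit at 0 applies, beyond \<open>d\<close> the bound linear in prices applies and
  \<open>x\<^sup>2 / d\<^sup>2 \<ge> 1\<close> inserts the square. The exponential rate is 1 because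
  the prices depend on \<open>x\<close> through \<open>exp x\<close>.\<close>

lemma A_bar_le_square_exp:
  assumes "P > 0" "\<gamma> \<ge> 0"
  obtains C where "C \<ge> 0" "\<And>x. x \<ge> 0 \<Longrightarrow> A_bar \<gamma> xs ys P x \<le> C * x\<^sup>2 * exp x"
proof -
  let ?g = "A_bar \<gamma> xs ys P"
  let ?D = "\<bar>A_curv \<gamma> P / 2\<bar> + 1"
  have "A_curv \<gamma> P / 2 < ?D" by simp
  from order_tendstoD(2)[OF A_bar_over_square[OF assms(1)] this]
  obtain d where d: "d > 0" "\<And>x. 0 < x \<Longrightarrow> x < d \<Longrightarrow> ?g x / x\<^sup>2 < ?D"
    by (auto simp: eventually_at_right_field)
  \<comment> \<open>The 4 counts the terms of the linear bound for the two sides together, each at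
    most \<open>exp (x + \<gamma>)\<close>.\<close>
  define K where "K = 4 * P * exp \<gamma> * A_const \<gamma>"
  have K: "K \<ge> 0" using assms by (simp add: K_def A_const_nonneg)
  have far: "?g x \<le> K * exp x" if "x \<ge> 0" for x
  proof -
    let ?A = "A_const \<gamma>"
    have "?g x \<le> A_plus \<gamma> xs ys P (x + \<gamma>) + A_minus \<gamma> xs ys P (- x - \<gamma>)"
      unfolding A_bar_def
      using add_nonneg_nonneg[OF A_nonneg(1)[OF assms(1), of \<gamma> "x + \<gamma>"]
        A_nonneg(2)[OF assms(1), of \<gamma> "- x - \<gamma>"]]
      by (simp add: divide_le_eq)
    also have "\<dots> \<le> A_total \<gamma> xs ys P (x + \<gamma>) + A_total \<gamma> xs ys P (- x - \<gamma>)"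
      using A_nonneg[OF assms(1)] by (simp add: A_total_def add_mono)
    also have "\<dots> \<le> ?A * (P + P * exp (- (x + \<gamma>))) + ?A * (P + P * exp (- (- x - \<gamma>)))"
      by (intro add_mono A_total_le assms)
    also have "\<dots> = ?A * P * (2 * 1 + exp (- (x + \<gamma>)) + exp (x + \<gamma>))"
      by (simp add: algebra_simps)
    also have "\<dots> \<le> ?A * P * (2 * exp (x + \<gamma>) + exp (x + \<gamma>) + exp (x + \<gamma>))"
      using assms that by (intro mult_left_mono add_mono) (auto simp: A_const_nonneg)
    also have "\<dots> = K * exp x" by (simp add: K_def exp_add)
    finally show ?thesis .
  qed
  show ?thesis
  proof (rule that[of "?D + K / d\<^sup>2"])
    show "?D + K / d\<^sup>2 \<ge> 0" using K d(1) by (intro add_nonneg_nonneg divide_nonneg_nonneg) auto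
    fix x :: real assume x: "x \<ge> 0"
    consider "x = 0" | "0 < x" "x < d" | "x \<ge> d" using x by linarith
    then show "?g x \<le> (?D + K / d\<^sup>2) * x\<^sup>2 * exp x"
    proof cases
      case 1 then show ?thesis by (simp add: A_bar_eq)
    next
      case 2
      have "?g x \<le> ?D * x\<^sup>2 * 1" using d(2)[OF 2] 2 by (simp add: field_simps)
      also have "\<dots> \<le> (?D + K / d\<^sup>2) * x\<^sup>2 * exp x"
        using 2 K by (intro mult_mono) auto
      finally show ?thesis .
    next
      case 3
      have "?g x \<le> K * 1 * exp x" using far[OF x] by simp
      also have "\<dots> \<le> K * (x\<^sup>2 / d\<^sup>2) * exp x"
        using 3 d(1) K by (intro mult_right_mono mult_left_mono) auto
      also have "\<dots> \<le> (?D + K / d\<^sup>2) * x\<^sup>2 * exp x"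
        by (intro mult_right_mono) (auto simp: algebra_simps)
      finally show ?thesis .
    qed
  qed
qed

end

section \<open>Laplace asymptotics and the invariant distribution\<close>

lemma has_bochner_integral_erlang_density:
  assumes "l > 0"
  shows "has_bochner_integral lborel (erlang_density k l) 1"
  by (rule has_bochner_integral_nn_integral)
    (use assms nn_integral_erlang_ith_moment[of l k 0] in auto)

text \<open>Substituting \<open>x = u / k\<close> turns \<open>k\<^sup>2\<close> times the integral
  into the integral of \<open>exp (- u) * k\<^sup>2 * g (u / k)\<close>, which converges pointwise
  to \<open>D * u\<^sup>2 * exp (- u) / 2\<close>, a multiple of a Gamma density. The growth of
  \<open>g\<close> costs a factor \<open>exp (u / k)\<close>, at most \<open>exp (u / 2)\<close> for
  \<open>k \<ge> 2\<close>, so dominated convergence applies.\<close>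

lemma laplace_quadratic:
  fixes g :: "real \<Rightarrow> real" and C D :: real
  assumes [measurable]: "g \<in> borel_measurable borel"
    and nonneg: "\<And>x. x \<ge> 0 \<Longrightarrow> 0 \<le> g x"
    and le: "\<And>x. x \<ge> 0 \<Longrightarrow> g x \<le> C * x\<^sup>2 * exp x"
    and lim: "((\<lambda>x. g x / x\<^sup>2) \<longlongrightarrow> D / 2) (at_right 0)"
  shows "\<And>k. k \<ge> 2 \<Longrightarrow> integrable lborel (\<lambda>x. exponential_density k x * g x)"
    and "((\<lambda>k. k\<^sup>2 * (\<integral>x. exponential_density k x * g x \<partial>lborel)) \<longlongrightarrow> D) at_top"
proof -
  define s where "s k u = indicator {0..} u * (exp (- u) * (k\<^sup>2 * g (u / k)))" for k u :: real
  \<comment> \<open>This is \<open>C * u\<^sup>2 * exp (- u / 2)\<close>: the Erlang density of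
    shape 3 and rate 1/2 carries the factor (1/2)^3 / 2! = 1/16. Written this way, integrability is
    immediate.\<close>
  define w where "w u = C * 16 * erlang_density 2 (1 / 2) u" for u :: real
  define h where "h u = D * erlang_density 2 1 u" for u :: real
  have [measurable]: "s k \<in> borel_measurable borel" for k unfolding s_def by measurable
  have [measurable]: "h \<in> borel_measurable borel" unfolding h_def by measurable
  have w: "integrable lborel w"
    unfolding w_def
    by (intro integrable_mult_right has_bochner_integral_erlang_density[THEN integrable.intros]) simp
  have "has_bochner_integral lborel h (D * 1)"
    unfolding h_def by (intro has_bochner_integral_mult_right has_bochner_integral_erlang_density) simp
  then have h: "integral\<^sup>L lborel h = D"
    by (simp add: has_bochner_integral_iff)
  have bound: "norm (s k u) \<le> w u" if "k \<ge> 2" for k u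
  proof (cases "u \<ge> 0")
    case True
    have "k\<^sup>2 * g (u / k) \<le> k\<^sup>2 * (C * (u / k)\<^sup>2 * exp (u / k))"
      using that True by (intro mult_left_mono le) auto
    also have "\<dots> = C * u\<^sup>2 * exp (u / k)" using that by (simp add: field_simps)
    finally have 1: "exp (- u) * (k\<^sup>2 * g (u / k)) \<le> exp (- u) * (C * u\<^sup>2 * exp (u / k))"
      by simp
    \<comment> \<open>The two bounds on \<open>g\<close> at the point 1 force the sign of
      \<open>C\<close>.\<close>
    have "0 \<le> C * 1\<^sup>2 * exp 1" using le[of 1] nonneg[of 1] by linarith
    then have C: "C \<ge> 0" by (simp add: zero_le_mult_iff)
    have "u / k \<le> u / 2" using that True by (intro divide_left_mono) auto
    then have "exp (- u) * (C * u\<^sup>2 * exp (u / k)) \<le> exp (- u) * (C * u\<^sup>2 * exp (u / 2))"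
      using C by (intro mult_left_mono) auto
    also have "\<dots> = C * u\<^sup>2 * (exp (- u) * exp (u / 2))" by simp
    also have "exp (- u) * exp (u / 2) = exp (- u / 2)" by (simp flip: exp_add)
    also have "C * u\<^sup>2 * exp (- u / 2) = w u"
      using True by (simp add: w_def erlang_density_def power2_eq_square eval_nat_numeral field_simps)
    finally have "exp (- u) * (k\<^sup>2 * g (u / k)) \<le> w u" using 1 by linarith
    then show ?thesis using True nonneg[of "u / k"] that by (simp add: s_def)
  next
    case False
    then show ?thesis by (simp add: s_def w_def erlang_density_def)
  qed
  have s_int: "integrable lborel (s k)" if "k \<ge> 2" for k
    by (rule Bochner_Integration.integrable_bound[OF w]) (use bound[OF that] in \<open>auto intro!: AE_I2 intro: order_trans[OF _ abs_ge_self]\<close>)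
  have s_eq: "k\<^sup>2 * (exponential_density k (u / k) * g (u / k)) = k * s k u" if "k \<ge> 2" for k u
    using that by (auto simp: s_def erlang_density_def indicator_def field_simps)
  show int: "integrable lborel (\<lambda>x. exponential_density k x * g x)" if "k \<ge> 2" for k
  proof -
    have "(\<lambda>u. exponential_density k (0 + 1 / k * u) * g (0 + 1 / k * u)) = (\<lambda>u. 1 / k * s k u)"
      using s_eq[OF that] that by (auto simp: field_simps fun_eq_iff power2_eq_square)
    then show ?thesis
      using lborel_integrable_real_affine_iff[of "1 / k" "\<lambda>x. exponential_density k x * g x" 0]
        s_int[OF that] that by auto
  qed
  have conv: "k\<^sup>2 * (\<integral>x. exponential_density k x * g x \<partial>lborel) = integral\<^sup>L lborel (s k)" if "k \<ge> 2" for k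
  proof -
    have "k\<^sup>2 * (\<integral>x. exponential_density k x * g x \<partial>lborel)
        = k\<^sup>2 * (1 / k * (\<integral>u. exponential_density k (u / k) * g (u / k) \<partial>lborel))"
      using lborel_integral_real_affine[of "1 / k" "\<lambda>x. exponential_density k x * g x" 0] that
      by simp
    also have "\<dots> = 1 / k * (\<integral>u. k\<^sup>2 * (exponential_density k (u / k) * g (u / k)) \<partial>lborel)"
      by simp
    also have "\<dots> = integral\<^sup>L lborel (s k)"
      using that by (simp only: s_eq) simp
    finally show ?thesis .
  qed
  have "((\<lambda>k. integral\<^sup>L lborel (s k)) \<longlongrightarrow> integral\<^sup>L lborel h) at_top"
  proof (rule integral_dominated_convergence_at_top[where w = w])
    show "integrable lborel w" by (rule w)
    show "eventually (\<lambda>k. AE u in lborel. norm (s k u) \<le> w u) at_top"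
      using eventually_ge_at_top[of "2 :: real"] by eventually_elim (intro AE_I2 bound)
    show "AE u in lborel. ((\<lambda>k. s k u) \<longlongrightarrow> h u) at_top"
      using AE_lborel_singleton[of 0]
    proof eventually_elim
      fix u :: real assume "u \<noteq> 0"
      show "((\<lambda>k. s k u) \<longlongrightarrow> h u) at_top"
      proof (cases "u > 0")
        case True
        have "filterlim (\<lambda>k. u / k) (at_right 0) at_top"
          using True by real_asymp
        from filterlim_compose[OF lim this]
        have "((\<lambda>k. exp (- u) * u\<^sup>2 * (g (u / k) / (u / k)\<^sup>2)) \<longlongrightarrow> exp (- u) * u\<^sup>2 * (D / 2)) at_top"
          by (rule tendsto_mult[OF tendsto_const])
        also have "exp (- u) * u\<^sup>2 * (D / 2) = h u"
          using True by (simp add: h_def erlang_density_def power2_eq_square eval_nat_numeral)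
        finally show ?thesis
          by (rule Lim_transform_eventually)
            (use eventually_gt_at_top[of 0] in eventually_elim, use True in \<open>simp add: s_def field_simps\<close>)
      next
        case False
        with \<open>u \<noteq> 0\<close> show ?thesis by (simp add: s_def h_def erlang_density_def)
      qed
    qed
  qed simp_all
  then show "((\<lambda>k. k\<^sup>2 * (\<integral>x. exponential_density k x * g x \<partial>lborel)) \<longlongrightarrow> D) at_top"
    unfolding h
    by (rule Lim_transform_eventually)
      (use eventually_ge_at_top[of 2] in eventually_elim, simp add: conv)
qed

section \<open>Integrals against the invariant density\<close>

lemma invariant_density_measurable [measurable]:
  "invariant_density \<sigma> \<gamma> lam \<in> borel_measurable borel"
  unfolding invariant_density_def[abs_def] Let_def by measurable

text \<open>The uniform part is killed by \<open>h\<close>, and the two tails are moved onto the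
  positive half-line, the left one by a reflection. As the exponential density vanishes on negative
  arguments, the two translated densities can simply be added.\<close>

lemma nn_integral_invariant_density_outside:
  fixes h :: "real \<Rightarrow> ennreal"
  assumes pos: "\<sigma> > 0" "\<gamma> > 0" "lam > 0"
    and [measurable]: "h \<in> borel_measurable borel"
    and zero: "\<And>z. \<bar>z\<bar> \<le> \<gamma> \<Longrightarrow> h z = 0"
  shows "(\<integral>\<^sup>+x. ennreal (invariant_density \<sigma> \<gamma> lam x) * h x \<partial>lborel)
    = (\<integral>\<^sup>+x. ennreal (P_trade \<sigma> \<gamma> lam / 2 * exponential_density (sqrt (2 * lam) / \<sigma>) x) *
        (h (x + \<gamma>) + h (- x - \<gamma>)) \<partial>lborel)"
proof -
  define d where "d x = ennreal (P_trade \<sigma> \<gamma> lam / 2 * exponential_density (sqrt (2 * lam) / \<sigma>) x)" for x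
  have [measurable]: "d \<in> borel_measurable borel" unfolding d_def by measurable
  have "ennreal (invariant_density \<sigma> \<gamma> lam x) * h x = d (x - \<gamma>) * h x + d (- \<gamma> - x) * h x" for x
  proof -
    have neg: "y < 0 \<Longrightarrow> d y = 0" for y by (simp add: d_def erlang_density_def)
    consider "\<bar>x\<bar> \<le> \<gamma>" | "x > \<gamma>" | "x < - \<gamma>" by linarith
    then show ?thesis
    proof cases
      case 1 then show ?thesis by (simp add: zero)
    next
      case 2
      then have "d (x - \<gamma>) = ennreal (invariant_density \<sigma> \<gamma> lam x)" "d (- \<gamma> - x) = 0"
        using pos by (simp_all add: neg) (simp add: invariant_density_def d_def P_trade_def Let_def)
      then show ?thesis by simp
    next
      case 3
      then have "d (- \<gamma> - x) = ennreal (invariant_density \<sigma> \<gamma> lam x)" "d (x - \<gamma>) = 0"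
        using pos by (simp_all add: neg) (simp add: invariant_density_def d_def P_trade_def Let_def)
      then show ?thesis by simp
    qed
  qed
  then have "(\<integral>\<^sup>+x. ennreal (invariant_density \<sigma> \<gamma> lam x) * h x \<partial>lborel)
      = (\<integral>\<^sup>+x. d (x - \<gamma>) * h x \<partial>lborel) + (\<integral>\<^sup>+x. d (- \<gamma> - x) * h x \<partial>lborel)"
    by (simp add: nn_integral_add)
  also have "(\<integral>\<^sup>+x. d (x - \<gamma>) * h x \<partial>lborel) = (\<integral>\<^sup>+x. d x * h (x + \<gamma>) \<partial>lborel)"
    by (subst nn_integral_real_affine[of _ 1 \<gamma>]) (auto simp: add.commute)
  also have "(\<integral>\<^sup>+x. d (- \<gamma> - x) * h x \<partial>lborel) = (\<integral>\<^sup>+x. d x * h (- x - \<gamma>) \<partial>lborel)"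
    by (subst nn_integral_real_affine[of _ "-1" "- \<gamma>"]) (auto simp: algebra_simps)
  finally show ?thesis
    by (simp add: nn_integral_add[symmetric] distrib_left d_def)
qed

lemma P_trade_pos: "\<sigma> > 0 \<Longrightarrow> \<gamma> > 0 \<Longrightarrow> lam > 0 \<Longrightarrow> P_trade \<sigma> \<gamma> lam > 0"
  by (simp add: P_trade_def add_pos_pos)

lemma nn_integral_erlang_density_1: "l > 0 \<Longrightarrow> (\<integral>\<^sup>+x. ennreal (erlang_density k l x) \<partial>lborel) = 1"
  using nn_integral_erlang_ith_moment[of l k 0] by simp

text \<open>Exponential tilting lowers the rate of the density by one, which is why
  \<open>k > 1\<close> is required.\<close>

lemma exponential_density_mult_exp:
  assumes "k > 1" "x \<ge> 0"
  shows "exponential_density k x * exp (x + a) = k / (k - 1) * exp a * exponential_density (k - 1) x"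
proof -
  have 1: "exponential_density k x = k * exp (- k * x)"
    "exponential_density (k - 1) x = (k - 1) * exp (- (k - 1) * x)"
    using assms by (simp_all add: erlang_density_def)
  have 2: "exp (- k * x) * exp (x + a) = exp a * exp (- (k - 1) * x)"
    unfolding exp_add[symmetric] by (rule arg_cong[of _ _ exp]) (simp add: algebra_simps)
  show ?thesis
    unfolding 1 mult.assoc 2 using assms(1) by simp
qed

text \<open>Only the left tail matters, since \<open>exp (- x) \<le> exp \<gamma>\<close> elsewhere.
  There the integrand is a tilted exponential density of rate \<open>k - 1\<close>. The finite value
  provides the majorant for the limit of short times.\<close>

lemma nn_integral_invariant_density_exp:
  assumes pos: "\<sigma> > 0" "\<gamma> > 0" "lam > 0"
    and prob: "prob_space (density lborel (invariant_density \<sigma> \<gamma> lam))"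
    and "sqrt (2 * lam) / \<sigma> > 1"
  shows "(\<integral>\<^sup>+x. ennreal (invariant_density \<sigma> \<gamma> lam x) * ennreal (exp (- x)) \<partial>lborel) < \<infinity>"
proof -
  interpret D: prob_space "density lborel (invariant_density \<sigma> \<gamma> lam)" by fact
  define k where "k = sqrt (2 * lam) / \<sigma>"
  have k: "k > 1" using assms(5) by (simp add: k_def)
  let ?h = "\<lambda>x. ennreal (exp (- x)) * indicator {..<- \<gamma>} x"
  have one: "(\<integral>\<^sup>+x. ennreal (invariant_density \<sigma> \<gamma> lam x) \<partial>lborel) = 1"
    using D.emeasure_space_1 by (simp add: emeasure_density)
  have "(\<integral>\<^sup>+x. ennreal (invariant_density \<sigma> \<gamma> lam x) * ennreal (exp (- x)) \<partial>lborel)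
    \<le> (\<integral>\<^sup>+x. ennreal (exp \<gamma>) * ennreal (invariant_density \<sigma> \<gamma> lam x)
        + ennreal (invariant_density \<sigma> \<gamma> lam x) * ?h x \<partial>lborel)"
  proof (rule nn_integral_mono)
    fix x
    have "ennreal (exp (- x)) \<le> ennreal (exp \<gamma>) + ?h x"
      by (cases "x < - \<gamma>") (auto intro!: ennreal_leI)
    then have "ennreal (invariant_density \<sigma> \<gamma> lam x) * ennreal (exp (- x))
      \<le> ennreal (invariant_density \<sigma> \<gamma> lam x) * (ennreal (exp \<gamma>) + ?h x)"
      by (rule mult_left_mono) simp
    then show "ennreal (invariant_density \<sigma> \<gamma> lam x) * ennreal (exp (- x))
      \<le> ennreal (exp \<gamma>) * ennreal (invariant_density \<sigma> \<gamma> lam x)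
        + ennreal (invariant_density \<sigma> \<gamma> lam x) * ?h x"
      by (simp only: distrib_left mult.commute[of "ennreal (exp \<gamma>)"])
  qed
  also have "\<dots> = ennreal (exp \<gamma>) * 1 + (\<integral>\<^sup>+x. ennreal (invariant_density \<sigma> \<gamma> lam x) * ?h x \<partial>lborel)"
    by (simp add: nn_integral_add nn_integral_cmult one)
  finally have *: "(\<integral>\<^sup>+x. ennreal (invariant_density \<sigma> \<gamma> lam x) * ennreal (exp (- x)) \<partial>lborel)
    \<le> ennreal (exp \<gamma>) * 1 + (\<integral>\<^sup>+x. ennreal (invariant_density \<sigma> \<gamma> lam x) * ?h x \<partial>lborel)" .
  have "(\<integral>\<^sup>+x. ennreal (invariant_density \<sigma> \<gamma> lam x) * ?h x \<partial>lborel)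
    = (\<integral>\<^sup>+x. ennreal (P_trade \<sigma> \<gamma> lam / 2 * exponential_density k x) *
        (?h (x + \<gamma>) + ?h (- x - \<gamma>)) \<partial>lborel)"
    unfolding k_def by (rule nn_integral_invariant_density_outside) (use pos in auto)
  also have "\<dots> \<le> (\<integral>\<^sup>+x. ennreal (P_trade \<sigma> \<gamma> lam / 2 * (k / (k - 1)) * exp \<gamma>) *
        ennreal (exponential_density (k - 1) x) \<partial>lborel)"
  proof (rule nn_integral_mono)
    fix x :: real
    show "ennreal (P_trade \<sigma> \<gamma> lam / 2 * exponential_density k x) * (?h (x + \<gamma>) + ?h (- x - \<gamma>))
      \<le> ennreal (P_trade \<sigma> \<gamma> lam / 2 * (k / (k - 1)) * exp \<gamma>) *
        ennreal (exponential_density (k - 1) x)"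
    proof (cases "x > 0")
      case True
      then have "?h (x + \<gamma>) + ?h (- x - \<gamma>) = ennreal (exp (x + \<gamma>))"
        using pos by (simp add: add.commute)
      then have "ennreal (P_trade \<sigma> \<gamma> lam / 2 * exponential_density k x) * (?h (x + \<gamma>) + ?h (- x - \<gamma>))
        = ennreal (P_trade \<sigma> \<gamma> lam / 2 * exponential_density k x * exp (x + \<gamma>))"
        by (simp only: ennreal_mult''[OF exp_ge_zero])
      also have "P_trade \<sigma> \<gamma> lam / 2 * exponential_density k x * exp (x + \<gamma>)
        = P_trade \<sigma> \<gamma> lam / 2 * (k / (k - 1)) * exp \<gamma> * exponential_density (k - 1) x"
        using True by (simp only: mult.assoc exponential_density_mult_exp[OF k less_imp_le])
      also have "ennreal \<dots> = ennreal (P_trade \<sigma> \<gamma> lam / 2 * (k / (k - 1)) * exp \<gamma>) *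
          ennreal (exponential_density (k - 1) x)"
        using k by (intro ennreal_mult'' erlang_density_nonneg) simp
      finally show ?thesis by simp
    next
      case False
      then have "?h (x + \<gamma>) + ?h (- x - \<gamma>) = 0 \<or> exponential_density k x = 0"
        using pos by (auto simp: erlang_density_def)
      then show ?thesis by auto
    qed
  qed
  also have "\<dots> = ennreal (P_trade \<sigma> \<gamma> lam / 2 * (k / (k - 1)) * exp \<gamma>)"
    using k by (simp add: nn_integral_cmult nn_integral_erlang_density_1)
  finally have "(\<integral>\<^sup>+x. ennreal (invariant_density \<sigma> \<gamma> lam x) * ?h x \<partial>lborel) < \<infinity>"
    by (rule order_le_less_trans) simp
  then have "ennreal (exp \<gamma>) * 1 + (\<integral>\<^sup>+x. ennreal (invariant_density \<sigma> \<gamma> lam x) * ?h x \<partial>lborel) < \<infinity>"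
    by simp
  with * show ?thesis by (rule order_le_less_trans)
qed

text \<open>No profit arises inside the band, and the two tails contribute \<open>2 * A_bar\<close>,
  which cancels the half mass of each tail. Integrability for \<open>k \<ge> 2\<close> permits the
  passage to a real integral.\<close>

lemma (in smooth_pool) nn_integral_invariant_density_A_total:
  assumes pos: "\<sigma> > 0" "\<gamma> > 0" "lam > 0" "P > 0"
    and "sqrt (2 * lam) / \<sigma> \<ge> 2"
  shows "(\<integral>\<^sup>+x. ennreal (invariant_density \<sigma> \<gamma> lam x) * ennreal (A_total \<gamma> xs ys P x) \<partial>lborel)
    = ennreal (P_trade \<sigma> \<gamma> lam *
        (\<integral>x. exponential_density (sqrt (2 * lam) / \<sigma>) x * A_bar \<gamma> xs ys P x \<partial>lborel))"
proof -
  define k where "k = sqrt (2 * lam) / \<sigma>"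
  have k: "k \<ge> 2" using assms(5) by (simp add: k_def)
  have [measurable]: "A_bar \<gamma> xs ys P \<in> borel_measurable borel"
    by (rule A_bar_measurable[OF pos(4)])
  have [measurable]: "A_total \<gamma> xs ys P \<in> borel_measurable borel"
    by (rule A_total_measurable_mispricing[OF pos(4)])
  obtain C where "C \<ge> 0" and C: "\<And>x. x \<ge> 0 \<Longrightarrow> A_bar \<gamma> xs ys P x \<le> C * x\<^sup>2 * exp x"
    using A_bar_le_square_exp[OF pos(4) less_imp_le[OF pos(2)]] by blast
  have int: "integrable lborel (\<lambda>x. exponential_density k x * A_bar \<gamma> xs ys P x)"
  proof (rule laplace_quadratic(1)[where C = C and D = "A_curv \<gamma> P"])
    show "((\<lambda>x. A_bar \<gamma> xs ys P x / x\<^sup>2) \<longlongrightarrow> A_curv \<gamma> P / 2) (at_right 0)"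
      by (rule A_bar_over_square[OF pos(4)])
  qed (use k C A_nonneg(4)[OF pos(4)] in simp_all)
  have c: "P_trade \<sigma> \<gamma> lam \<ge> 0" using P_trade_pos[of \<sigma> \<gamma> lam] pos by simp
  have zero: "A_total \<gamma> xs ys P z = 0" if "\<bar>z\<bar> \<le> \<gamma>" for z
    using that by (auto simp: A_total_def A_plus_def A_minus_def)
  have "(\<integral>\<^sup>+x. ennreal (invariant_density \<sigma> \<gamma> lam x) * ennreal (A_total \<gamma> xs ys P x) \<partial>lborel)
    = (\<integral>\<^sup>+x. ennreal (P_trade \<sigma> \<gamma> lam / 2 * exponential_density k x) *
        (ennreal (A_total \<gamma> xs ys P (x + \<gamma>)) + ennreal (A_total \<gamma> xs ys P (- x - \<gamma>))) \<partial>lborel)"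
    unfolding k_def
  proof (rule nn_integral_invariant_density_outside[OF pos(1-3)])
    show "(\<lambda>x. ennreal (A_total \<gamma> xs ys P x)) \<in> borel_measurable borel" by measurable
  qed (simp add: zero)
  also have "\<dots> = (\<integral>\<^sup>+x. ennreal (P_trade \<sigma> \<gamma> lam *
      (exponential_density k x * A_bar \<gamma> xs ys P x)) \<partial>lborel)"
  proof (rule nn_integral_cong)
    fix x :: real
    show "ennreal (P_trade \<sigma> \<gamma> lam / 2 * exponential_density k x) *
        (ennreal (A_total \<gamma> xs ys P (x + \<gamma>)) + ennreal (A_total \<gamma> xs ys P (- x - \<gamma>)))
      = ennreal (P_trade \<sigma> \<gamma> lam * (exponential_density k x * A_bar \<gamma> xs ys P x))"
    proof (cases "x < 0")
      case True
      then show ?thesis by (simp add: erlang_density_def)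
    next
      case False
      have "A_total \<gamma> xs ys P (x + \<gamma>) + A_total \<gamma> xs ys P (- x - \<gamma>) = 2 * A_bar \<gamma> xs ys P x"
      proof (cases "x = 0")
        case True
        then show ?thesis using pos by (simp add: zero A_bar_eq)
      next
        case False
        then show ?thesis using \<open>\<not> x < 0\<close> pos by (intro A_total_eq_A_bar) auto
      qed
      then have "ennreal (A_total \<gamma> xs ys P (x + \<gamma>)) + ennreal (A_total \<gamma> xs ys P (- x - \<gamma>))
          = ennreal (2 * A_bar \<gamma> xs ys P x)"
        by (simp only: ennreal_plus[OF A_nonneg(3)[OF pos(4)] A_nonneg(3)[OF pos(4)], symmetric])
      moreover have "0 \<le> 2 * A_bar \<gamma> xs ys P x" using A_nonneg(4)[OF pos(4)] by simp
      ultimately show ?thesis by (simp only: ennreal_mult''[symmetric]) simp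
    qed
  qed
  also have "\<dots> = ennreal (P_trade \<sigma> \<gamma> lam *
        (\<integral>x. exponential_density k x * A_bar \<gamma> xs ys P x \<partial>lborel))"
  proof (subst nn_integral_eq_integral)
    show "integrable lborel (\<lambda>x. P_trade \<sigma> \<gamma> lam * (exponential_density k x * A_bar \<gamma> xs ys P x))"
      using int by (rule integrable_mult_right)
    show "AE x in lborel. 0 \<le> P_trade \<sigma> \<gamma> lam * (exponential_density k x * A_bar \<gamma> xs ys P x)"
      using c k by (intro AE_I2 mult_nonneg_nonneg erlang_density_nonneg A_nonneg(4)[OF pos(4)]) auto
  qed simp
  finally show ?thesis unfolding k_def .
qed

section \<open>Independence and path evaluation\<close>

text \<open>The joint law is the product of the marginal laws, and Tonelli applies. The independent
  copy is obtained by integrating over a second point of the same space.\<close>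

lemma (in prob_space) indep_rv_nn_integral:
  fixes F :: "_ \<Rightarrow> ennreal"
  assumes indep: "indep_rv M S X T Y"
    and space: "X \<in> space M \<rightarrow> space S" "Y \<in> space M \<rightarrow> space T"
    and F [measurable]: "F \<in> borel_measurable (S \<Otimes>\<^sub>M T)"
  shows "(\<integral>\<^sup>+\<omega>. F (X \<omega>, Y \<omega>) \<partial>M) = (\<integral>\<^sup>+\<omega>'. \<integral>\<^sup>+\<omega>. F (X \<omega>, Y \<omega>') \<partial>M \<partial>M)"
proof -
  note ind = indep[unfolded indep_rv_def]
  \<comment> \<open>Measurability is contained in independence, since the generated sigma-algebras
    must consist of events.\<close>
  have X [measurable]: "X \<in> measurable M S"
    using indep_setD_ev1[OF ind] space
    by (intro measurableI) (blast, blast intro: in_vimage_algebra)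
  have Y [measurable]: "Y \<in> measurable M T"
    using indep_setD_ev2[OF ind] space
    by (intro measurableI) (blast, blast intro: in_vimage_algebra)
  interpret X: prob_space "distr M S X" by (rule prob_space_distr) fact
  interpret Y: prob_space "distr M T Y" by (rule prob_space_distr) fact
  interpret XY: pair_prob_space "distr M S X" "distr M T Y" ..
  have eq: "distr M S X \<Otimes>\<^sub>M distr M T Y = distr M (S \<Otimes>\<^sub>M T) (\<lambda>\<omega>. (X \<omega>, Y \<omega>))"
  proof (rule pair_measure_eqI)
    fix A B assume "A \<in> sets (distr M S X)" "B \<in> sets (distr M T Y)"
    then have AB [measurable]: "A \<in> sets S" "B \<in> sets T" by auto
    have "prob ((X -` A \<inter> space M) \<inter> (Y -` B \<inter> space M)) = prob (X -` A \<inter> space M) * prob (Y -` B \<inter> space M)"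
      by (intro indep_setD[OF ind] in_vimage_algebra AB)
    also have "(X -` A \<inter> space M) \<inter> (Y -` B \<inter> space M) = (\<lambda>\<omega>. (X \<omega>, Y \<omega>)) -` (A \<times> B) \<inter> space M"
      by auto
    finally show "emeasure (distr M S X) A * emeasure (distr M T Y) B
        = emeasure (distr M (S \<Otimes>\<^sub>M T) (\<lambda>\<omega>. (X \<omega>, Y \<omega>))) (A \<times> B)"
      by (simp add: emeasure_distr emeasure_eq_measure ennreal_mult del: vimage_Int)
  qed (rule X.sigma_finite_measure_axioms, rule Y.sigma_finite_measure_axioms, simp cong: sets_pair_measure_cong)
  have F' [measurable]: "F \<in> borel_measurable (distr M S X \<Otimes>\<^sub>M distr M T Y)" by simp
  have "(\<integral>\<^sup>+\<omega>. F (X \<omega>, Y \<omega>) \<partial>M) = integral\<^sup>N (distr M S X \<Otimes>\<^sub>M distr M T Y) F"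
    unfolding eq by (simp add: nn_integral_distr)
  also have "\<dots> = (\<integral>\<^sup>+y. \<integral>\<^sup>+x. F (x, y) \<partial>distr M S X \<partial>distr M T Y)"
    by (rule XY.nn_integral_snd[symmetric]) simp
  also have "\<dots> = (\<integral>\<^sup>+\<omega>'. \<integral>\<^sup>+x. F (x, Y \<omega>') \<partial>distr M S X \<partial>M)"
  proof (rule nn_integral_distr[OF Y])
    have "(\<lambda>y. \<integral>\<^sup>+x. F (x, y) \<partial>distr M S X) \<in> borel_measurable (distr M T Y)"
      by (rule X.borel_measurable_nn_integral) (use F' in \<open>simp add: measurable_pair_swap_iff[of F]\<close>)
    then show "(\<lambda>y. \<integral>\<^sup>+x. F (x, y) \<partial>distr M S X) \<in> borel_measurable (distr M T Y)" by simp
  qed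
  also have "\<dots> = (\<integral>\<^sup>+\<omega>'. \<integral>\<^sup>+\<omega>. F (X \<omega>, Y \<omega>') \<partial>M \<partial>M)"
  proof (rule nn_integral_cong)
    fix \<omega>' assume "\<omega>' \<in> space M"
    then have "Y \<omega>' \<in> space T" using space by blast
    then have "(\<lambda>x. F (x, Y \<omega>')) \<in> borel_measurable S"
      by (rule measurable_compose[OF measurable_Pair2' F])
    then show "(\<integral>\<^sup>+x. F (x, Y \<omega>') \<partial>distr M S X) = (\<integral>\<^sup>+\<omega>. F (X \<omega>, Y \<omega>') \<partial>M)"
      by (intro nn_integral_distr X) simp
  qed
  finally show ?thesis .
qed

text \<open>Evaluation of a path at a time is not measurable on the full product space; this limit along
  ever finer uniform grids is, and it agrees with evaluation on continuous paths.\<close>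

definition path_eval :: "(real \<Rightarrow> real) \<Rightarrow> real \<Rightarrow> real" where
  "path_eval w t = lim (\<lambda>n. w (real (nat \<lceil>t * real (Suc n)\<rceil>) / real (Suc n)))"

text \<open>For each \<open>n\<close> the grid index takes countably many values, and for a fixed
  index evaluation is a coordinate map. The use of \<open>nat\<close> keeps the grid point in the
  index set \<open>{0..}\<close> even for negative times.\<close>

lemma path_eval_measurable:
  "(\<lambda>p. path_eval (fst p) (snd p)) \<in> borel_measurable ((\<Pi>\<^sub>M t\<in>{0..}. borel) \<Otimes>\<^sub>M borel)"
  unfolding path_eval_def
proof (rule borel_measurable_lim_metric)
  fix n
  let ?N = "(\<Pi>\<^sub>M t\<in>{0..}. borel) \<Otimes>\<^sub>M borel :: ((real \<Rightarrow> real) \<times> real) measure"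
  show "(\<lambda>p. fst p (real (nat \<lceil>snd p * real (Suc n)\<rceil>) / real (Suc n))) \<in> borel_measurable ?N"
  proof (rule measurable_compose_countable[where f = "\<lambda>m p. fst p (real m / real (Suc n))"])
    fix m :: nat
    have "(\<lambda>w :: real \<Rightarrow> real. w (real m / real (Suc n))) \<in> borel_measurable (\<Pi>\<^sub>M t\<in>{0..}. borel)"
      by (rule measurable_component_singleton) simp
    then show "(\<lambda>p. fst p (real m / real (Suc n))) \<in> borel_measurable ?N"
      by (rule measurable_compose[OF measurable_fst])
  qed measurable
qed

lemma path_eval_continuous:
  assumes "continuous_on {0..} w" "t \<ge> 0"
  shows "path_eval (\<lambda>t\<in>{0..}. w t) t = w t"
proof -
  let ?d = "\<lambda>n. real (nat \<lceil>t * real (Suc n)\<rceil>) / real (Suc n)"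
  have "?d \<longlonglongrightarrow> t"
  proof (rule tendsto_sandwich)
    show "(\<lambda>n. t) \<longlonglongrightarrow> t" by simp
    show "(\<lambda>n. t + 1 / real (Suc n)) \<longlonglongrightarrow> t"
      using tendsto_add[OF tendsto_const LIMSEQ_inverse_real_of_nat, of t] by (simp add: inverse_eq_divide)
    have *: "t * real (Suc n) \<le> real (nat \<lceil>t * real (Suc n)\<rceil>)"
        "real (nat \<lceil>t * real (Suc n)\<rceil>) \<le> t * real (Suc n) + 1" for n
    proof -
      have "t * real (Suc n) \<ge> 0" using assms(2) by simp
      then have "real (nat \<lceil>t * real (Suc n)\<rceil>) = real_of_int \<lceil>t * real (Suc n)\<rceil>"
        by (intro of_nat_nat) linarith
      then show "t * real (Suc n) \<le> real (nat \<lceil>t * real (Suc n)\<rceil>)"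
        "real (nat \<lceil>t * real (Suc n)\<rceil>) \<le> t * real (Suc n) + 1" by linarith+
    qed
    have "t \<le> ?d n" for n
      using *(1)[of n] by (simp add: le_divide_eq del: of_nat_Suc)
    then show "eventually (\<lambda>n. t \<le> ?d n) sequentially" by simp
    have "?d n \<le> t + 1 / real (Suc n)" for n
    proof -
      have "?d n \<le> (t * real (Suc n) + 1) / real (Suc n)"
        by (rule divide_right_mono[OF *(2)]) simp
      also have "\<dots> = t + 1 / real (Suc n)" by (simp add: add_divide_distrib del: of_nat_Suc)
      finally show ?thesis .
    qed
    then show "eventually (\<lambda>n. ?d n \<le> t + 1 / real (Suc n)) sequentially" by simp
  qed
  moreover have "eventually (\<lambda>n. ?d n \<in> {0..}) sequentially"
    by (intro always_eventually allI, unfold atLeast_iff) (intro divide_nonneg_nonneg of_nat_0_le_iff)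
  ultimately have "(\<lambda>n. w (?d n)) \<longlonglongrightarrow> w t"
    using assms(2) by (intro continuous_on_tendsto_compose[OF assms(1)]) auto
  then show ?thesis
    unfolding path_eval_def by (intro limI) simp
qed

text \<open>Completing the square: the tilted centred density is a multiple of the normal density
  with mean \<open>a * s\<^sup>2\<close>.\<close>

lemma normal_exp_moment:
  assumes "s > 0"
  shows "(\<integral>\<^sup>+x. ennreal (normal_density 0 s x) * ennreal (exp (a * x)) \<partial>lborel) = ennreal (exp (a\<^sup>2 * s\<^sup>2 / 2))"
proof -
  have eq: "normal_density 0 s x * exp (a * x) = exp (a\<^sup>2 * s\<^sup>2 / 2) * normal_density (a * s\<^sup>2) s x" for x
  proof -
    have "- (x\<^sup>2 / (2 * s\<^sup>2)) + a * x = a\<^sup>2 * s\<^sup>2 / 2 + - ((x - a * s\<^sup>2)\<^sup>2 / (2 * s\<^sup>2))"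
      using assms by (simp add: field_simps power2_eq_square)
    then have "exp (- (x\<^sup>2 / (2 * s\<^sup>2))) * exp (a * x) = exp (a\<^sup>2 * s\<^sup>2 / 2) * exp (- ((x - a * s\<^sup>2)\<^sup>2 / (2 * s\<^sup>2)))"
      by (simp only: exp_add[symmetric])
    then show ?thesis by (simp add: normal_density_def)
  qed
  interpret N: prob_space "density lborel (normal_density (a * s\<^sup>2) s)"
    by (rule prob_space_normal_density) fact
  have one: "(\<integral>\<^sup>+x. ennreal (normal_density (a * s\<^sup>2) s x) \<partial>lborel) = 1"
    using N.emeasure_space_1 by (simp add: emeasure_density)
  have "(\<integral>\<^sup>+x. ennreal (normal_density 0 s x) * ennreal (exp (a * x)) \<partial>lborel)
      = (\<integral>\<^sup>+x. ennreal (exp (a\<^sup>2 * s\<^sup>2 / 2)) * ennreal (normal_density (a * s\<^sup>2) s x) \<partial>lborel)"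
    by (simp add: ennreal_mult''[symmetric] eq ennreal_mult'[symmetric] normal_density_nonneg)
  then show ?thesis by (simp add: nn_integral_cmult one)
qed

section \<open>Arbitrage profits\<close>

locale arbitrage_model = mispricing_model M \<sigma> \<gamma> lam B \<tau> z\<^sub>0 z + smooth_pool f L xs ys V1 V2
  for M :: "'a measure" and \<sigma> \<gamma> lam B \<tau> z\<^sub>0 z f L xs ys V1 V2 +
  fixes P :: real
  assumes pos: "\<sigma> > 0" "\<gamma> > 0" "lam > 0" "P > 0"
begin

lemma B_measurable [measurable]: "t \<ge> 0 \<Longrightarrow> B t \<in> borel_measurable M"
  using brownian by (auto simp: brownian_motion_def)

lemma B_0: "\<omega> \<in> space M \<Longrightarrow> B 0 \<omega> = 0"
  using brownian by (auto simp: brownian_motion_def)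

lemma B_continuous: "\<omega> \<in> space M \<Longrightarrow> continuous_on {0..} (\<lambda>t. B t \<omega>)"
  using brownian by (auto simp: brownian_motion_def)

lemma B_distributed:
  assumes "t > 0"
  shows "distributed M lborel (B t) (normal_density 0 (sqrt t))"
proof -
  have "distributed M lborel (\<lambda>\<omega>. B t \<omega> - B 0 \<omega>) (normal_density 0 (sqrt (t - 0)))"
    using brownian assms unfolding brownian_motion_def by blast
  then show ?thesis
    using assms distr_cong[of M M lborel lborel "\<lambda>\<omega>. B t \<omega> - B 0 \<omega>" "B t"]
    by (simp add: distributed_def B_0)
qed

lemma \<tau>_0: "\<omega> \<in> space M \<Longrightarrow> \<tau> 0 \<omega> = 0"
  using poisson by (auto simp: poisson_arrivals_def)

lemma \<tau>_strict_mono: "\<omega> \<in> space M \<Longrightarrow> strict_mono (\<lambda>i. \<tau> i \<omega>)"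
  using poisson by (auto simp: poisson_arrivals_def)

lemma \<tau>_less_iff: "\<omega> \<in> space M \<Longrightarrow> \<tau> i \<omega> < \<tau> j \<omega> \<longleftrightarrow> i < j"
  by (rule strict_mono_less[OF \<tau>_strict_mono])

lemma \<tau>_mono: "\<omega> \<in> space M \<Longrightarrow> i \<le> j \<Longrightarrow> \<tau> i \<omega> \<le> \<tau> j \<omega>"
  by (simp add: strict_mono_less_eq[OF \<tau>_strict_mono])

lemma \<tau>_nonneg: "\<omega> \<in> space M \<Longrightarrow> 0 \<le> \<tau> i \<omega>"
  using \<tau>_mono[of \<omega> 0 i] \<tau>_0 by simp

lemma waiting_distributed:
  "distributed M lborel (\<lambda>\<omega>. \<tau> (Suc i) \<omega> - \<tau> i \<omega>) (exponential_density lam)"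
  using poisson by (auto simp: poisson_arrivals_def)

lemma waiting_measurable [measurable]: "(\<lambda>\<omega>. \<tau> (Suc i) \<omega> - \<tau> i \<omega>) \<in> borel_measurable M"
  using distributed_measurable[OF waiting_distributed[of i]] by simp

lemma \<tau>_measurable [measurable]: "\<tau> i \<in> borel_measurable M"
proof (induction i)
  case 0
  have "(\<lambda>\<omega>. 0 :: real) \<in> borel_measurable M" by simp
  then show ?case by (subst measurable_cong[where g = "\<lambda>\<omega>. 0"]) (simp_all add: \<tau>_0)
next
  case (Suc i)
  have "(\<lambda>\<omega>. (\<tau> (Suc i) \<omega> - \<tau> i \<omega>) + \<tau> i \<omega>) \<in> borel_measurable M"
    by (intro borel_measurable_add waiting_measurable Suc)
  then show ?case by simp
qed

lemma z\<^sub>0_measurable [measurable]: "z\<^sub>0 \<in> borel_measurable M"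
  using distributed_measurable[OF initial] by simp

section \<open>Independent copies of the initial mispricing, the Brownian path and the
  arrivals\<close>

definition B_path :: "'a \<Rightarrow> real \<Rightarrow> real" where
  "B_path \<omega> = (\<lambda>t\<in>{0..}. B t \<omega>)"

abbreviation "path_space \<equiv> \<Pi>\<^sub>M t\<in>{0 :: real..}. (borel :: real measure)"

abbreviation "time_space \<equiv> \<Pi>\<^sub>M i\<in>(UNIV :: nat set). (borel :: real measure)"

lemma B_path_eval: "\<omega> \<in> space M \<Longrightarrow> t \<ge> 0 \<Longrightarrow> path_eval (B_path \<omega>) t = B t \<omega>"
  unfolding B_path_def by (intro path_eval_continuous B_continuous)

lemma B_path_measurable [measurable]: "B_path \<in> measurable M path_space"
  unfolding B_path_def[abs_def] by (intro measurable_restrict) simp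

lemma \<tau>_seq_measurable [measurable]: "(\<lambda>\<omega> i. \<tau> i \<omega>) \<in> measurable M time_space"
proof -
  have "(\<lambda>\<omega>. \<lambda>i\<in>UNIV. \<tau> i \<omega>) \<in> measurable M time_space"
    by (intro measurable_restrict \<tau>_measurable)
  then show ?thesis by (simp add: restrict_def)
qed

lemma B_\<tau>_measurable [measurable]: "(\<lambda>\<omega>. B (\<tau> i \<omega>) \<omega>) \<in> borel_measurable M"
proof -
  have "(\<lambda>\<omega>. path_eval (fst (B_path \<omega>, \<tau> i \<omega>)) (snd (B_path \<omega>, \<tau> i \<omega>))) \<in> borel_measurable M"
    by (rule measurable_compose[OF _ path_eval_measurable]) measurable
  then show ?thesis
    by (subst measurable_cong[where g = "\<lambda>\<omega>. path_eval (B_path \<omega>) (\<tau> i \<omega>)"])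
      (simp_all add: B_path_eval \<tau>_nonneg)
qed

lemma nn_integral_B_\<tau>:
  fixes F :: "(real \<Rightarrow> real) \<times> (nat \<Rightarrow> real) \<Rightarrow> ennreal"
  assumes "F \<in> borel_measurable (path_space \<Otimes>\<^sub>M time_space)"
  shows "(\<integral>\<^sup>+\<omega>. F (B_path \<omega>, \<lambda>i. \<tau> i \<omega>) \<partial>M) = (\<integral>\<^sup>+\<omega>'. \<integral>\<^sup>+\<omega>. F (B_path \<omega>, \<lambda>i. \<tau> i \<omega>') \<partial>M \<partial>M)"
proof (rule indep_rv_nn_integral[where S = path_space and T = time_space and Y = "\<lambda>\<omega> i. \<tau> i \<omega>"])
  show "indep_rv M path_space B_path time_space (\<lambda>\<omega> i. \<tau> i \<omega>)"
    using indep_B_arrivals unfolding B_path_def[abs_def] .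
qed (use assms measurable_space[OF B_path_measurable] measurable_space[OF \<tau>_seq_measurable] in auto)

text \<open>Two separations in a row: the initial mispricing is independent of the pair, and then
  the path is independent of the arrivals.\<close>

lemma nn_integral_z\<^sub>0_B_\<tau>:
  fixes F :: "real \<times> (real \<Rightarrow> real) \<times> (nat \<Rightarrow> real) \<Rightarrow> ennreal"
  assumes F: "F \<in> borel_measurable (borel \<Otimes>\<^sub>M (path_space \<Otimes>\<^sub>M time_space))"
  shows "(\<integral>\<^sup>+\<omega>. F (z\<^sub>0 \<omega>, B_path \<omega>, \<lambda>i. \<tau> i \<omega>) \<partial>M)
    = (\<integral>\<^sup>+\<omega>''. \<integral>\<^sup>+\<omega>'. \<integral>\<^sup>+\<omega>. F (z\<^sub>0 \<omega>, B_path \<omega>', \<lambda>i. \<tau> i \<omega>'') \<partial>M \<partial>M \<partial>M)"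
proof -
  have "(\<integral>\<^sup>+\<omega>. F (z\<^sub>0 \<omega>, B_path \<omega>, \<lambda>i. \<tau> i \<omega>) \<partial>M)
      = (\<integral>\<^sup>+\<omega>'. \<integral>\<^sup>+\<omega>. F (z\<^sub>0 \<omega>, B_path \<omega>', \<lambda>i. \<tau> i \<omega>') \<partial>M \<partial>M)"
  proof (rule indep_rv_nn_integral[where S = borel and T = "path_space \<Otimes>\<^sub>M time_space"
        and X = z\<^sub>0 and Y = "\<lambda>\<omega>. (B_path \<omega>, \<lambda>i. \<tau> i \<omega>)", OF _ _ _ F])
    show "indep_rv M borel z\<^sub>0 (path_space \<Otimes>\<^sub>M time_space) (\<lambda>\<omega>. (B_path \<omega>, \<lambda>i. \<tau> i \<omega>))"
      using indep_initial unfolding B_path_def[abs_def] .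
  qed (use measurable_space[OF B_path_measurable] measurable_space[OF \<tau>_seq_measurable]
      in \<open>auto simp: space_pair_measure\<close>)
  also have "\<dots> = (\<integral>\<^sup>+\<omega>''. \<integral>\<^sup>+\<omega>'. \<integral>\<^sup>+\<omega>. F (z\<^sub>0 \<omega>, B_path \<omega>', \<lambda>i. \<tau> i \<omega>'') \<partial>M \<partial>M \<partial>M)"
  proof (rule nn_integral_B_\<tau>[where F = "\<lambda>p. \<integral>\<^sup>+\<omega>. F (z\<^sub>0 \<omega>, p) \<partial>M", simplified])
    show "(\<lambda>p. \<integral>\<^sup>+\<omega>. F (z\<^sub>0 \<omega>, p) \<partial>M) \<in> borel_measurable (path_space \<Otimes>\<^sub>M time_space)"
    proof (rule borel_measurable_nn_integral)
      have "(\<lambda>q. F (z\<^sub>0 (snd q), fst q)) \<in> borel_measurable ((path_space \<Otimes>\<^sub>M time_space) \<Otimes>\<^sub>M M)"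
        by (rule measurable_compose[OF _ F]) measurable
      then show "(\<lambda>(p, \<omega>). F (z\<^sub>0 \<omega>, p)) \<in> borel_measurable ((path_space \<Otimes>\<^sub>M time_space) \<Otimes>\<^sub>M M)"
        by (simp add: split_beta')
    qed
  qed
  finally show ?thesis .
qed

section \<open>Mispricing and profits at arrivals\<close>

definition z_left :: "nat \<Rightarrow> 'a \<Rightarrow> real" where
  "z_left i \<omega> = z (\<tau> i \<omega>) \<omega> + \<sigma> * (B (\<tau> (Suc i) \<omega>) \<omega> - B (\<tau> i \<omega>) \<omega>)"

text \<open>Since no arrival falls strictly between two consecutive ones, the path follows the
  continuous Brownian increment up to the next arrival. Mind the shift: \<open>z_left i\<close>
  belongs to arrival \<open>Suc i\<close>, and \<open>z_left 0\<close> starts at the time origin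
  \<open>\<tau> 0\<close>, which is not an arrival.\<close>

lemma left_lim_z:
  assumes "\<omega> \<in> space M"
  shows "left_lim (\<lambda>t. z t \<omega>) (\<tau> (Suc i) \<omega>) = z_left i \<omega>"
proof -
  let ?r = "\<tau> i \<omega>" and ?t = "\<tau> (Suc i) \<omega>"
  have r: "0 \<le> ?r" "?r < ?t" using \<tau>_nonneg assms by (auto simp: \<tau>_less_iff)
  have eq: "z s \<omega> = z ?r \<omega> + \<sigma> * (B s \<omega> - B ?r \<omega>)" if "?r < s" "s < ?t" for s
  proof -
    have "\<tau> j \<omega> \<notin> {?r<..s}" for j
    proof
      assume "\<tau> j \<omega> \<in> {?r<..s}"
      then have "?r < \<tau> j \<omega>" "\<tau> j \<omega> < ?t" using that by auto
      then have "i < j" "j < Suc i"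
        by (simp_all only: \<tau>_less_iff[OF assms])
      then show False by simp
    qed
    then have "z s \<omega> - z ?r \<omega> = \<sigma> * (B s \<omega> - B ?r \<omega>)"
      using mispricing[OF assms] r(1) that(1) unfolding mispricing_path_def by auto
    then show ?thesis by simp
  qed
  have "isCont (\<lambda>s. B s \<omega>) ?t"
    using B_continuous[OF assms] r by (intro continuous_on_interior[where S = "{0..}"]) auto
  then have "((\<lambda>s. B s \<omega>) \<longlongrightarrow> B ?t \<omega>) (at_left ?t)"
    unfolding isCont_def by (rule tendsto_within_subset) simp
  then have "((\<lambda>s. z ?r \<omega> + \<sigma> * (B s \<omega> - B ?r \<omega>)) \<longlongrightarrow> z_left i \<omega>) (at_left ?t)"
    unfolding z_left_def by (intro tendsto_intros)
  moreover have "eventually (\<lambda>s. z ?r \<omega> + \<sigma> * (B s \<omega> - B ?r \<omega>) = z s \<omega>) (at_left ?t)"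
    using eventually_at_left_real[OF r(2)] by eventually_elim (simp add: eq)
  ultimately have "((\<lambda>s. z s \<omega>) \<longlongrightarrow> z_left i \<omega>) (at_left ?t)"
    by (rule Lim_transform_eventually)
  then show ?thesis
    unfolding left_lim_def by (intro tendsto_Lim) auto
qed

lemma z_\<tau>_0: "\<omega> \<in> space M \<Longrightarrow> z (\<tau> 0 \<omega>) \<omega> = z\<^sub>0 \<omega>"
  using mispricing \<tau>_0 by (auto simp: mispricing_path_def)

lemma z_\<tau>_Suc: "\<omega> \<in> space M \<Longrightarrow> z (\<tau> (Suc i) \<omega>) \<omega> = max (min (z_left i \<omega>) \<gamma>) (- \<gamma>)"
  using mispricing left_lim_z by (auto simp: mispricing_path_def)

text \<open>The model describes \<open>z\<close> path by path only, so measurability at arrivals is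
  carried along the recursion from one arrival to the next.\<close>

lemma z_\<tau>_measurable [measurable]: "(\<lambda>\<omega>. z (\<tau> i \<omega>) \<omega>) \<in> borel_measurable M"
proof (induction i)
  case 0
  show ?case by (subst measurable_cong[where g = z\<^sub>0]) (simp_all add: z_\<tau>_0)
next
  case (Suc i)
  have [measurable]: "z_left i \<in> borel_measurable M"
    unfolding z_left_def[abs_def]
    by (intro borel_measurable_add borel_measurable_times borel_measurable_diff
        borel_measurable_const B_\<tau>_measurable Suc)
  show ?case
    by (subst measurable_cong[where g = "\<lambda>\<omega>. max (min (z_left i \<omega>) \<gamma>) (- \<gamma>)"])
      (simp_all add: z_\<tau>_Suc)
qed

lemma z_left_measurable [measurable]: "z_left i \<in> borel_measurable M"
  unfolding z_left_def[abs_def] by measurable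

text \<open>The profit at arrival \<open>Suc i\<close>. For the drift
  \<open>\<sigma>\<^sup>2 / 2\<close> the exponent of the price reduces to the Brownian
  term.\<close>

definition gain :: "nat \<Rightarrow> 'a \<Rightarrow> real" where
  "gain i \<omega> = A_total \<gamma> xs ys (P * exp (\<sigma> * B (\<tau> (Suc i) \<omega>) \<omega>)) (z_left i \<omega>)"

lemma gain_measurable [measurable]: "gain i \<in> borel_measurable M"
  unfolding gain_def[abs_def] by (intro A_total_measurable pos) measurable

lemma gain_nonneg: "gain i \<omega> \<ge> 0"
  unfolding gain_def using pos by (intro A_nonneg) simp

lemma ARB_eq:
  assumes "\<omega> \<in> space M"
  shows "ARB \<sigma> \<gamma> xs ys P B \<tau> z T \<omega> = (\<Sum>i<arrival_count \<tau> T \<omega>. gain i \<omega>)"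
  unfolding ARB_def gain_def One_nat_def sum.atLeast1_atMost_eq
  using assms by (simp add: price_def left_lim_z)

lemma ARB_nonneg: "\<omega> \<in> space M \<Longrightarrow> ARB \<sigma> \<gamma> xs ys P B \<tau> z T \<omega> \<ge> 0"
  by (simp add: ARB_eq sum_nonneg gain_nonneg)

lemma ARB_measurable [measurable]: "ARB \<sigma> \<gamma> xs ys P B \<tau> z T \<in> borel_measurable M"
proof -
  have [measurable]: "arrival_count \<tau> T \<in> measurable M (count_space UNIV)"
    unfolding arrival_count_def[abs_def] by (rule measurable_card) measurable
  have "(\<lambda>\<omega>. \<Sum>i<arrival_count \<tau> T \<omega>. gain i \<omega>) \<in> borel_measurable M"
    by (rule measurable_compose_countable[where f = "\<lambda>n \<omega>. \<Sum>i<n. gain i \<omega>"]) measurable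
  then show ?thesis
    by (subst measurable_cong[where g = "\<lambda>\<omega>. \<Sum>i<arrival_count \<tau> T \<omega>. gain i \<omega>"]) (simp_all add: ARB_eq)
qed

text \<open>A sum of random length becomes a fixed series, which can be integrated termwise. An
  arrival after \<open>T\<close> is required because \<open>arrival_count\<close> is a
  \<open>card\<close>, which would be 0 for infinitely many arrivals.\<close>

lemma ARB_eq_suminf:
  assumes \<omega>: "\<omega> \<in> space M" and "T < \<tau> n \<omega>" "T \<ge> 0"
  shows "ennreal (ARB \<sigma> \<gamma> xs ys P B \<tau> z T \<omega>)
    = (\<Sum>i. ennreal (gain i \<omega>) * indicator {..T} (\<tau> (Suc i) \<omega>))"
proof -
  define m where "m = (LEAST n. T < \<tau> n \<omega>)"
  have m: "T < \<tau> m \<omega>" unfolding m_def using assms(2) by (rule LeastI)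
  have iff: "\<tau> i \<omega> \<le> T \<longleftrightarrow> i < m" for i
  proof
    assume "\<tau> i \<omega> \<le> T"
    then have "\<tau> i \<omega> < \<tau> m \<omega>" using m by simp
    then show "i < m" by (simp only: \<tau>_less_iff[OF \<omega>])
  next
    assume "i < m"
    then show "\<tau> i \<omega> \<le> T" using not_less_Least[of i "\<lambda>n. T < \<tau> n \<omega>"] by (simp add: m_def)
  qed
  have "{i. 1 \<le> i \<and> \<tau> i \<omega> \<le> T} = {1..<m}" by (auto simp: iff)
  \<comment> \<open>One less than \<open>m\<close>, because the time origin \<open>\<tau> 0\<close>
    is not counted as an arrival.\<close>
  then have "arrival_count \<tau> T \<omega> = m - 1" by (simp add: arrival_count_def)
  then have "ennreal (ARB \<sigma> \<gamma> xs ys P B \<tau> z T \<omega>) = (\<Sum>i<m - 1. ennreal (gain i \<omega>))"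
    using \<omega> by (simp add: ARB_eq gain_nonneg)
  also have "\<dots> = (\<Sum>i<m - 1. ennreal (gain i \<omega>) * indicator {..T} (\<tau> (Suc i) \<omega>))"
    by (intro sum.cong) (auto simp: iff)
  also have "\<dots> = (\<Sum>i. ennreal (gain i \<omega>) * indicator {..T} (\<tau> (Suc i) \<omega>))"
    by (rule suminf_finite[symmetric]) (auto simp: iff indicator_def)
  finally show ?thesis .
qed

text \<open>If the n-th arrival occurs by \<open>T\<close>, each of the first \<open>n\<close>
  waiting times is at most \<open>T\<close>; these are independent, each of probability at most
  \<open>lam * T\<close>. Though cruder than the Poisson tail, the bound is summable for small
  \<open>T\<close> and quadratic from the second arrival on.\<close>

lemma prob_\<tau>_le:
  assumes "T \<ge> 0"
  shows "prob {\<omega> \<in> space M. \<tau> n \<omega> \<le> T} \<le> (lam * T) ^ n"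
proof (cases "n = 0")
  case False
  let ?W = "\<lambda>j \<omega>. \<tau> (Suc j) \<omega> - \<tau> j \<omega>"
  have W: "prob (?W j -` {..T} \<inter> space M) = 1 - exp (- T * lam)" for j
  proof -
    have "?W j -` {..T} \<inter> space M = {\<omega> \<in> space M. ?W j \<omega> \<le> T}" by auto
    then show ?thesis
      using exponential_distributedD_le[OF waiting_distributed assms pos(3), of j] by simp
  qed
  have "{\<omega> \<in> space M. \<tau> n \<omega> \<le> T} \<subseteq> (\<Inter>j\<in>{..<n}. ?W j -` {..T} \<inter> space M)"
  proof (intro subsetI INT_I IntI)
    fix \<omega> j assume *: "\<omega> \<in> {\<omega> \<in> space M. \<tau> n \<omega> \<le> T}" "j \<in> {..<n}"
    then have "\<tau> (Suc j) \<omega> \<le> \<tau> n \<omega>" by (intro \<tau>_mono) auto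
    then show "\<omega> \<in> ?W j -` {..T}" using * \<tau>_nonneg[of \<omega> j] by auto
  qed auto
  then have "prob {\<omega> \<in> space M. \<tau> n \<omega> \<le> T} \<le> prob (\<Inter>j\<in>{..<n}. ?W j -` {..T} \<inter> space M)"
    using False measurable_sets[OF waiting_measurable, of "{..T}"]
    by (intro finite_measure_mono sets.finite_INT) (simp_all add: lessThan_empty_iff)
  also have "\<dots> = (\<Prod>j\<in>{..<n}. prob (?W j -` {..T} \<inter> space M))"
    using poisson False by (intro indep_varsD[where I = UNIV and M' = "\<lambda>_. borel"])
      (auto simp: poisson_arrivals_def)
  also have "\<dots> = (1 - exp (- T * lam)) ^ n" by (simp only: W) simp
  also have "\<dots> \<le> (lam * T) ^ n"
  proof (rule power_mono)
    show "1 - exp (- T * lam) \<le> lam * T" using exp_ge_add_one_self[of "- T * lam"] by (simp add: mult.commute)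
    show "0 \<le> 1 - exp (- T * lam)" using assms pos by simp
  qed
  finally show ?thesis .
qed simp

lemma AE_finitely_many_arrivals:
  assumes "T \<ge> 0" "lam * T < 1"
  shows "AE \<omega> in M. \<exists>n. T < \<tau> n \<omega>"
proof (rule AE_I)
  let ?N = "{\<omega> \<in> space M. \<forall>n. \<tau> n \<omega> \<le> T}"
  have "prob ?N \<le> (lam * T) ^ n" for n
  proof -
    have "prob ?N \<le> prob {\<omega> \<in> space M. \<tau> n \<omega> \<le> T}"
      by (rule finite_measure_mono) auto
    then show ?thesis using prob_\<tau>_le[OF assms(1), of n] by linarith
  qed
  moreover have "(\<lambda>n. (lam * T) ^ n) \<longlonglongrightarrow> 0"
    using assms pos by (intro LIMSEQ_power_zero) simp
  ultimately have "prob ?N \<le> 0"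
    by (intro LIMSEQ_le_const) auto
  then have "prob ?N = 0" using measure_nonneg[of M ?N] by linarith
  then show "emeasure M ?N = 0" by (simp add: emeasure_eq_measure)
  show "{\<omega> \<in> space M. \<not> (\<exists>n. T < \<tau> n \<omega>)} \<subseteq> ?N" by (auto simp: not_less)
qed simp

section \<open>Exponential moments and the arrivals after the first\<close>

lemma nn_integral_B:
  assumes "t \<ge> 0" and [measurable]: "G \<in> borel_measurable borel"
  shows "(\<integral>\<^sup>+\<omega>. G (B t \<omega>) \<partial>M) = (\<integral>\<^sup>+x. G (sqrt t * x) \<partial>density lborel std_normal_density)"
proof -
  interpret N: prob_space "density lborel std_normal_density"
    by (rule prob_space_normal_density) simp
  show ?thesis
  proof (cases "t = 0")
    case True
    have "(\<integral>\<^sup>+\<omega>. G (B t \<omega>) \<partial>M) = (\<integral>\<^sup>+\<omega>. G 0 \<partial>M)"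
      by (rule nn_integral_cong) (simp add: True B_0)
    then show ?thesis using True N.emeasure_space_1 emeasure_space_1 by simp
  next
    case False
    then have t: "t > 0" using assms(1) by simp
    have "distributed (density lborel std_normal_density) lborel (\<lambda>x. x) std_normal_density"
      by (auto simp: distributed_def intro!: distr_id2)
    from N.normal_density_affine[OF this, of "sqrt t" 0]
    have "distributed (density lborel std_normal_density) lborel (\<lambda>x. sqrt t * x) (normal_density 0 (sqrt t))"
      using t by simp
    from distributed_nn_integral[OF this, of G] distributed_nn_integral[OF B_distributed[OF t], of G]
    show ?thesis by simp
  qed
qed

lemma nn_integral_std_normal_exp:
  "(\<integral>\<^sup>+x. ennreal (exp (a * x)) \<partial>density lborel std_normal_density) = ennreal (exp (a\<^sup>2 / 2))"
  using normal_exp_moment[of 1 a] by (simp add: nn_integral_density)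

lemma nn_integral_exp_B:
  assumes "t \<ge> 0"
  shows "(\<integral>\<^sup>+\<omega>. ennreal (exp (a * B t \<omega>)) \<partial>M) = ennreal (exp (a\<^sup>2 * t / 2))"
proof -
  have "(\<integral>\<^sup>+\<omega>. ennreal (exp (a * B t \<omega>)) \<partial>M)
      = (\<integral>\<^sup>+x. ennreal (exp ((a * sqrt t) * x)) \<partial>density lborel std_normal_density)"
    by (subst nn_integral_B[OF assms, of "\<lambda>b. ennreal (exp (a * b))"]) (simp_all add: mult.assoc)
  then show ?thesis
    using assms by (simp only: nn_integral_std_normal_exp) (simp add: power_mult_distrib)
qed

lemma path_eval_measurable':
  "(\<lambda>p. path_eval (fst p) (snd p i)) \<in> borel_measurable (path_space \<Otimes>\<^sub>M time_space)"
proof -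
  have "(\<lambda>p. path_eval (fst (fst p, snd p i)) (snd (fst p, snd p i)))
      \<in> borel_measurable (path_space \<Otimes>\<^sub>M time_space)"
    by (rule measurable_compose[OF _ path_eval_measurable]) measurable
  then show ?thesis by simp
qed

text \<open>With the arrivals frozen, the Gaussian moment at \<open>\<tau> j\<close> is at most
  \<open>exp (a\<^sup>2 * T / 2)\<close>, because \<open>\<tau> j\<close> does not exceed
  \<open>\<tau> i\<close>, which is at most \<open>T\<close> on the event. The event contributes the
  power of \<open>lam * T\<close>.\<close>

lemma nn_integral_exp_B_\<tau>_le:
  assumes "j \<le> i" "T \<ge> 0"
  shows "(\<integral>\<^sup>+\<omega>. ennreal (exp (a * B (\<tau> j \<omega>) \<omega>)) * indicator {..T} (\<tau> i \<omega>) \<partial>M)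
    \<le> ennreal (exp (a\<^sup>2 * T / 2) * (lam * T) ^ i)"
proof -
  let ?F = "\<lambda>p. ennreal (exp (a * path_eval (fst p) (snd p j))) * indicator {..T} (snd p i)"
  note [measurable] = path_eval_measurable'
  have "(\<integral>\<^sup>+\<omega>. ennreal (exp (a * B (\<tau> j \<omega>) \<omega>)) * indicator {..T} (\<tau> i \<omega>) \<partial>M)
      = (\<integral>\<^sup>+\<omega>. ?F (B_path \<omega>, \<lambda>i. \<tau> i \<omega>) \<partial>M)"
    by (rule nn_integral_cong) (simp add: B_path_eval \<tau>_nonneg)
  also have "\<dots> = (\<integral>\<^sup>+\<omega>'. \<integral>\<^sup>+\<omega>. ?F (B_path \<omega>, \<lambda>i. \<tau> i \<omega>') \<partial>M \<partial>M)"
    by (rule nn_integral_B_\<tau>) measurable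
  also have "\<dots> \<le> (\<integral>\<^sup>+\<omega>'. ennreal (exp (a\<^sup>2 * T / 2)) * indicator {\<omega> \<in> space M. \<tau> i \<omega> \<le> T} \<omega>' \<partial>M)"
  proof (rule nn_integral_mono)
    fix \<omega>' assume \<omega>': "\<omega>' \<in> space M"
    have "(\<integral>\<^sup>+\<omega>. ?F (B_path \<omega>, \<lambda>i. \<tau> i \<omega>') \<partial>M)
      = (\<integral>\<^sup>+\<omega>. ennreal (exp (a * B (\<tau> j \<omega>') \<omega>)) * indicator {..T} (\<tau> i \<omega>') \<partial>M)"
      using \<omega>' by (intro nn_integral_cong) (simp add: B_path_eval \<tau>_nonneg)
    also have "\<dots> = ennreal (exp (a\<^sup>2 * \<tau> j \<omega>' / 2)) * indicator {..T} (\<tau> i \<omega>')"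
      using \<tau>_nonneg[OF \<omega>'] by (simp add: nn_integral_multc nn_integral_exp_B)
    also have "\<dots> \<le> ennreal (exp (a\<^sup>2 * T / 2)) * indicator {\<omega> \<in> space M. \<tau> i \<omega> \<le> T} \<omega>'"
    proof (cases "\<tau> i \<omega>' \<le> T")
      case True
      then have "\<tau> j \<omega>' \<le> T" using \<tau>_mono[OF \<omega>' assms(1)] by simp
      then show ?thesis using True \<omega>' by (auto intro!: ennreal_leI mult_left_mono)
    qed simp
    finally show "(\<integral>\<^sup>+\<omega>. ?F (B_path \<omega>, \<lambda>i. \<tau> i \<omega>') \<partial>M)
      \<le> ennreal (exp (a\<^sup>2 * T / 2)) * indicator {\<omega> \<in> space M. \<tau> i \<omega> \<le> T} \<omega>'" .
  qed
  also have "\<dots> = ennreal (exp (a\<^sup>2 * T / 2) * prob {\<omega> \<in> space M. \<tau> i \<omega> \<le> T})"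
    by (simp add: nn_integral_cmult emeasure_eq_measure ennreal_mult')
  also have "\<dots> \<le> ennreal (exp (a\<^sup>2 * T / 2) * (lam * T) ^ i)"
    using prob_\<tau>_le[OF assms(2)] by (intro ennreal_leI mult_left_mono) auto
  finally show ?thesis .
qed

text \<open>The pool price before an arrival is the one left by the previous arrival, and there the
  projection gives a mispricing of at least \<open>- \<gamma>\<close>. The first arrival is
  excluded, since the initial mispricing is unbounded.\<close>

lemma gain_Suc_le:
  assumes "\<omega> \<in> space M"
  shows "gain (Suc i) \<omega> \<le> A_const \<gamma> * P *
    (exp (\<sigma> * B (\<tau> (Suc (Suc i)) \<omega>) \<omega>) + exp \<gamma> * exp (\<sigma> * B (\<tau> (Suc i) \<omega>) \<omega>))"
proof -
  let ?b = "B (\<tau> (Suc (Suc i)) \<omega>) \<omega>" and ?b' = "B (\<tau> (Suc i) \<omega>) \<omega>"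
  have "exp (\<sigma> * ?b) * exp (- z_left (Suc i) \<omega>) = exp (\<sigma> * ?b' - z (\<tau> (Suc i) \<omega>) \<omega>)"
    unfolding exp_add[symmetric] by (rule arg_cong[of _ _ exp]) (simp add: z_left_def algebra_simps)
  also have "\<dots> \<le> exp (\<gamma> + \<sigma> * ?b')"
    using pos by (simp add: z_\<tau>_Suc[OF assms])
  finally have "exp (\<sigma> * ?b) * exp (- z_left (Suc i) \<omega>) \<le> exp \<gamma> * exp (\<sigma> * ?b')"
    by (simp only: exp_add)
  then have "A_const \<gamma> * P * (exp (\<sigma> * ?b) + exp (\<sigma> * ?b) * exp (- z_left (Suc i) \<omega>))
      \<le> A_const \<gamma> * P * (exp (\<sigma> * ?b) + exp \<gamma> * exp (\<sigma> * ?b'))"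
    using pos A_const_nonneg by (intro mult_left_mono add_left_mono) auto
  moreover have "gain (Suc i) \<omega> \<le> A_const \<gamma> * (P * exp (\<sigma> * ?b) + P * exp (\<sigma> * ?b) * exp (- z_left (Suc i) \<omega>))"
    unfolding gain_def using pos by (intro A_total_le) auto
  ultimately show ?thesis by (simp add: algebra_simps)
qed

text \<open>The terms 1 and \<open>exp \<gamma>\<close> belong to the external prices at the current
  and at the previous arrival; the last factor is the Gaussian moment for horizons
  \<open>T \<le> 1\<close>.\<close>

definition tail_const :: real where
  "tail_const = A_const \<gamma> * P * (1 + exp \<gamma>) * exp (\<sigma>\<^sup>2 / 2)"

lemma tail_const_nonneg: "tail_const \<ge> 0"
  using pos by (simp add: tail_const_def A_const_nonneg)

lemma nn_integral_gain_Suc_le: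
  assumes "0 \<le> T" "T \<le> 1"
  shows "(\<integral>\<^sup>+\<omega>. ennreal (gain (Suc i) \<omega>) * indicator {..T} (\<tau> (Suc (Suc i)) \<omega>) \<partial>M)
    \<le> ennreal (tail_const * (lam * T) ^ (i + 2))"
proof -
  let ?K = "A_const \<gamma> * P" and ?i = "Suc (Suc i)"
  let ?e = "\<lambda>j \<omega>. ennreal (exp (\<sigma> * B (\<tau> j \<omega>) \<omega>)) * indicator {..T} (\<tau> ?i \<omega>)"
  have K: "?K \<ge> 0" using pos A_const_nonneg by simp
  have e: "(\<integral>\<^sup>+\<omega>. ?e j \<omega> \<partial>M) \<le> ennreal (exp (\<sigma>\<^sup>2 / 2) * (lam * T) ^ ?i)" if "j \<le> ?i" for j
  proof -
    have "exp (\<sigma>\<^sup>2 * T / 2) * (lam * T) ^ ?i \<le> exp (\<sigma>\<^sup>2 / 2) * (lam * T) ^ ?i"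
      using assms pos by (intro mult_right_mono) (auto intro: mult_left_le)
    then show ?thesis
      using nn_integral_exp_B_\<tau>_le[OF that assms(1), of \<sigma>] by (meson ennreal_leI order_trans)
  qed
  have "(\<integral>\<^sup>+\<omega>. ennreal (gain (Suc i) \<omega>) * indicator {..T} (\<tau> ?i \<omega>) \<partial>M)
    \<le> (\<integral>\<^sup>+\<omega>. ennreal ?K * (?e ?i \<omega> + ennreal (exp \<gamma>) * ?e (Suc i) \<omega>) \<partial>M)"
  proof (rule nn_integral_mono)
    fix \<omega> assume \<omega>: "\<omega> \<in> space M"
    have "ennreal (gain (Suc i) \<omega>) \<le> ennreal (?K *
        (exp (\<sigma> * B (\<tau> ?i \<omega>) \<omega>) + exp \<gamma> * exp (\<sigma> * B (\<tau> (Suc i) \<omega>) \<omega>)))"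
      by (rule ennreal_leI[OF gain_Suc_le[OF \<omega>]])
    also have "\<dots> = ennreal ?K * (ennreal (exp (\<sigma> * B (\<tau> ?i \<omega>) \<omega>))
        + ennreal (exp \<gamma>) * ennreal (exp (\<sigma> * B (\<tau> (Suc i) \<omega>) \<omega>)))"
      using K by (simp add: ennreal_mult'[OF K] ennreal_mult'[OF exp_ge_zero])
    finally show "ennreal (gain (Suc i) \<omega>) * indicator {..T} (\<tau> ?i \<omega>)
      \<le> ennreal ?K * (?e ?i \<omega> + ennreal (exp \<gamma>) * ?e (Suc i) \<omega>)"
      by (cases "\<tau> ?i \<omega> \<le> T") simp_all
  qed
  also have "\<dots> = ennreal ?K * ((\<integral>\<^sup>+\<omega>. ?e ?i \<omega> \<partial>M) + ennreal (exp \<gamma>) * (\<integral>\<^sup>+\<omega>. ?e (Suc i) \<omega> \<partial>M))"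
    by (simp add: nn_integral_cmult nn_integral_add)
  also have "\<dots> \<le> ennreal ?K * (ennreal (exp (\<sigma>\<^sup>2 / 2) * (lam * T) ^ ?i)
      + ennreal (exp \<gamma>) * ennreal (exp (\<sigma>\<^sup>2 / 2) * (lam * T) ^ ?i))"
    by (intro mult_left_mono add_mono e) auto
  also have "\<dots> = ennreal (?K * (exp (\<sigma>\<^sup>2 / 2) * (lam * T) ^ ?i + exp \<gamma> * (exp (\<sigma>\<^sup>2 / 2) * (lam * T) ^ ?i)))"
    using assms pos K by (simp add: ennreal_mult'[OF K] ennreal_mult'[OF exp_ge_zero])
  also have "?K * (exp (\<sigma>\<^sup>2 / 2) * (lam * T) ^ ?i + exp \<gamma> * (exp (\<sigma>\<^sup>2 / 2) * (lam * T) ^ ?i))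
      = tail_const * (lam * T) ^ (i + 2)"
    by (simp add: tail_const_def algebra_simps)
  finally show ?thesis .
qed

lemma suminf_gain_Suc_le:
  assumes "0 \<le> T" "T \<le> 1" "lam * T \<le> 1 / 2"
  shows "(\<Sum>i. \<integral>\<^sup>+\<omega>. ennreal (gain (Suc i) \<omega>) * indicator {..T} (\<tau> (Suc (Suc i)) \<omega>) \<partial>M)
    \<le> ennreal (2 * tail_const * (lam * T)\<^sup>2)"
proof -
  let ?r = "lam * T"
  have r: "0 \<le> ?r" "?r < 1" using assms pos by auto
  have "(\<lambda>i. tail_const * ?r\<^sup>2 * ?r ^ i) sums (tail_const * ?r\<^sup>2 * (1 / (1 - ?r)))"
    using r by (intro sums_mult geometric_sums) simp
  then have sums: "(\<lambda>i. tail_const * ?r ^ (i + 2)) sums (tail_const * ?r\<^sup>2 * (1 / (1 - ?r)))"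
    by (simp add: power2_eq_square algebra_simps)
  have "(\<Sum>i. \<integral>\<^sup>+\<omega>. ennreal (gain (Suc i) \<omega>) * indicator {..T} (\<tau> (Suc (Suc i)) \<omega>) \<partial>M)
      \<le> (\<Sum>i. ennreal (tail_const * ?r ^ (i + 2)))"
    by (intro suminf_le nn_integral_gain_Suc_le assms) auto
  also have "\<dots> = ennreal (tail_const * ?r\<^sup>2 * (1 / (1 - ?r)))"
    by (rule suminf_ennreal_eq[OF _ sums]) (use r tail_const_nonneg in auto)
  also have "\<dots> \<le> ennreal (2 * tail_const * ?r\<^sup>2)"
  proof (rule ennreal_leI)
    have "1 / (1 - ?r) \<le> 2" using assms(3) by (simp add: divide_le_eq)
    then have "tail_const * ?r\<^sup>2 * (1 / (1 - ?r)) \<le> tail_const * ?r\<^sup>2 * 2"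
      using tail_const_nonneg by (intro mult_left_mono) auto
    then show "tail_const * ?r\<^sup>2 * (1 / (1 - ?r)) \<le> 2 * tail_const * ?r\<^sup>2" by simp
  qed
  finally show ?thesis .
qed

section \<open>Expected profit at the first arrival\<close>

definition mean_gain :: "real \<Rightarrow> ennreal" where
  "mean_gain t = (\<integral>\<^sup>+\<omega>'. \<integral>\<^sup>+\<omega>. ennreal (A_total \<gamma> xs ys (P * exp (\<sigma> * B t \<omega>')) (z\<^sub>0 \<omega> + \<sigma> * B t \<omega>')) \<partial>M \<partial>M)"

text \<open>Freezing the arrivals leaves the expected profit of a first arrival at a deterministic
  time, with initial mispricing and Brownian value drawn independently; this is
  \<open>mean_gain\<close>.\<close>

lemma nn_integral_gain_0:
  "(\<integral>\<^sup>+\<omega>. ennreal (gain 0 \<omega>) * indicator {..T} (\<tau> (Suc 0) \<omega>) \<partial>M)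
    = (\<integral>\<^sup>+\<omega>. mean_gain (\<tau> (Suc 0) \<omega>) * indicator {..T} (\<tau> (Suc 0) \<omega>) \<partial>M)"
proof -
  let ?ev = "\<lambda>q :: real \<times> (real \<Rightarrow> real) \<times> (nat \<Rightarrow> real). path_eval (fst (snd q)) (snd (snd q) (Suc 0))"
  let ?F = "\<lambda>q. ennreal (A_total \<gamma> xs ys (P * exp (\<sigma> * ?ev q)) (fst q + \<sigma> * ?ev q))
    * indicator {..T} (snd (snd q) (Suc 0))"
  have [measurable]: "?ev \<in> borel_measurable (borel \<Otimes>\<^sub>M (path_space \<Otimes>\<^sub>M time_space))"
    by (rule measurable_compose[OF measurable_snd path_eval_measurable'])
  have [measurable]: "(\<lambda>q. A_total \<gamma> xs ys (P * exp (\<sigma> * ?ev q)) (fst q + \<sigma> * ?ev q))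
      \<in> borel_measurable (borel \<Otimes>\<^sub>M (path_space \<Otimes>\<^sub>M time_space))"
    by (rule A_total_measurable[OF pos(4)]) measurable
  have "(\<integral>\<^sup>+\<omega>. ennreal (gain 0 \<omega>) * indicator {..T} (\<tau> (Suc 0) \<omega>) \<partial>M)
    = (\<integral>\<^sup>+\<omega>. ?F (z\<^sub>0 \<omega>, B_path \<omega>, \<lambda>i. \<tau> i \<omega>) \<partial>M)"
    using z_\<tau>_0
    by (intro nn_integral_cong) (simp add: gain_def z_left_def B_path_eval \<tau>_nonneg \<tau>_0 B_0)
  also have "\<dots> = (\<integral>\<^sup>+\<omega>''. \<integral>\<^sup>+\<omega>'. \<integral>\<^sup>+\<omega>. ?F (z\<^sub>0 \<omega>, B_path \<omega>', \<lambda>i. \<tau> i \<omega>'') \<partial>M \<partial>M \<partial>M)"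
    by (rule nn_integral_z\<^sub>0_B_\<tau>) measurable
  also have "\<dots> = (\<integral>\<^sup>+\<omega>. mean_gain (\<tau> (Suc 0) \<omega>) * indicator {..T} (\<tau> (Suc 0) \<omega>) \<partial>M)"
  proof (rule nn_integral_cong)
    fix \<omega>'' assume \<omega>'': "\<omega>'' \<in> space M"
    let ?t = "\<tau> (Suc 0) \<omega>''"
    have "(\<integral>\<^sup>+\<omega>'. \<integral>\<^sup>+\<omega>. ?F (z\<^sub>0 \<omega>, B_path \<omega>', \<lambda>i. \<tau> i \<omega>'') \<partial>M \<partial>M)
      = (\<integral>\<^sup>+\<omega>'. \<integral>\<^sup>+\<omega>. ennreal (A_total \<gamma> xs ys (P * exp (\<sigma> * B ?t \<omega>')) (z\<^sub>0 \<omega> + \<sigma> * B ?t \<omega>'))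
          * indicator {..T} ?t \<partial>M \<partial>M)"
      using \<omega>'' by (intro nn_integral_cong) (simp add: B_path_eval \<tau>_nonneg)
    also have "\<dots> = mean_gain ?t * indicator {..T} ?t"
      by (cases "?t \<le> T") (simp_all add: mean_gain_def)
    finally show "(\<integral>\<^sup>+\<omega>'. \<integral>\<^sup>+\<omega>. ?F (z\<^sub>0 \<omega>, B_path \<omega>', \<lambda>i. \<tau> i \<omega>'') \<partial>M \<partial>M)
      = mean_gain ?t * indicator {..T} ?t" .
  qed
  finally show ?thesis .
qed

text \<open>The first coordinate is the normal variable that replaces the Brownian value; the second
  carries the initial mispricing.\<close>

definition noise :: "(real \<times> 'a) measure" where
  "noise = density lborel std_normal_density \<Otimes>\<^sub>M M"

lemma nn_integral_noise:
  assumes "F \<in> borel_measurable noise"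
  shows "integral\<^sup>N noise F = (\<integral>\<^sup>+x. \<integral>\<^sup>+\<omega>. F (x, \<omega>) \<partial>M \<partial>density lborel std_normal_density)"
  using nn_integral_fst[of F "density lborel std_normal_density"] assms by (simp add: noise_def)

lemma noise_measurable:
  "fst \<in> borel_measurable noise" "(\<lambda>p. z\<^sub>0 (snd p)) \<in> borel_measurable noise"
proof -
  have "sets noise = sets (borel \<Otimes>\<^sub>M M)" unfolding noise_def by (intro sets_pair_measure_cong) auto
  note * = measurable_cong_sets[OF this refl]
  show "fst \<in> borel_measurable noise" "(\<lambda>p. z\<^sub>0 (snd p)) \<in> borel_measurable noise"
    unfolding * by measurable
qed

lemma A_total_noise_measurable:
  "(\<lambda>p. ennreal (A_total \<gamma> xs ys (P * exp (\<sigma> * (r * fst p))) (z\<^sub>0 (snd p) + \<sigma> * (r * fst p))))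
    \<in> borel_measurable noise"
proof -
  note [measurable] = noise_measurable
  have "(\<lambda>p. A_total \<gamma> xs ys (P * exp (\<sigma> * (r * fst p))) (z\<^sub>0 (snd p) + \<sigma> * (r * fst p)))
      \<in> borel_measurable noise"
    by (rule A_total_measurable[OF pos(4)]) measurable
  then show ?thesis by (rule measurable_compose[OF _ measurable_ennreal])
qed

text \<open>Scaling replaces the Brownian value by \<open>sqrt t\<close> times a fixed normal variable, which puts all
  times on one probability space and permits dominated convergence as \<open>t\<close> tends to \<open>0\<close>.\<close>

lemma mean_gain_eq:
  assumes "t \<ge> 0"
  shows "mean_gain t = (\<integral>\<^sup>+p. ennreal (A_total \<gamma> xs ys (P * exp (\<sigma> * (sqrt t * fst p)))
    (z\<^sub>0 (snd p) + \<sigma> * (sqrt t * fst p))) \<partial>noise)"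
proof -
  let ?G = "\<lambda>b. \<integral>\<^sup>+\<omega>. ennreal (A_total \<gamma> xs ys (P * exp (\<sigma> * b)) (z\<^sub>0 \<omega> + \<sigma> * b)) \<partial>M"
  have "?G \<in> borel_measurable borel"
  proof (rule borel_measurable_nn_integral)
    have "(\<lambda>p. A_total \<gamma> xs ys (P * exp (\<sigma> * fst p)) (z\<^sub>0 (snd p) + \<sigma> * fst p))
        \<in> borel_measurable (borel \<Otimes>\<^sub>M M)"
      by (rule A_total_measurable[OF pos(4)]) measurable
    then show "(\<lambda>(b, \<omega>). ennreal (A_total \<gamma> xs ys (P * exp (\<sigma> * b)) (z\<^sub>0 \<omega> + \<sigma> * b)))
        \<in> borel_measurable (borel \<Otimes>\<^sub>M M)"
      by (simp add: split_beta')
  qed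
  then show ?thesis
    unfolding mean_gain_def nn_integral_noise[OF A_total_noise_measurable] fst_conv snd_conv
    by (rule nn_integral_B[OF assms, of ?G])
qed

lemma nn_integral_z\<^sub>0:
  fixes h :: "real \<Rightarrow> ennreal"
  assumes "h \<in> borel_measurable borel"
  shows "(\<integral>\<^sup>+\<omega>. h (z\<^sub>0 \<omega>) \<partial>M) = (\<integral>\<^sup>+x. ennreal (invariant_density \<sigma> \<gamma> lam x) * h x \<partial>lborel)"
  using distributed_nn_integral[OF initial, of h] assms by simp

lemma prob_space_invariant_density: "prob_space (density lborel (invariant_density \<sigma> \<gamma> lam))"
  using prob_space_distr[OF distributed_measurable[OF initial]] distributed_distr_eq_density[OF initial]
  by simp

text \<open>Dominated convergence. The external price is bounded by exponentials of the normal
  variable in both directions, uniformly for times in [0, 1]; the pool price contributes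
  \<open>exp (- z\<^sub>0)\<close>, integrable by \<open>k > 1\<close>.\<close>

lemma mean_gain_tendsto:
  assumes k: "sqrt (2 * lam) / \<sigma> > 1"
  shows "(mean_gain \<longlongrightarrow> mean_gain 0) (at_right 0)"
proof -
  let ?u = "\<lambda>r p. ennreal (A_total \<gamma> xs ys (P * exp (\<sigma> * (r * fst p))) (z\<^sub>0 (snd p) + \<sigma> * (r * fst p)))"
  let ?w = "\<lambda>p. ennreal (A_const \<gamma> * P) *
    ((ennreal (exp (\<sigma> * fst p)) + ennreal (exp (- \<sigma> * fst p))) + ennreal (exp (- z\<^sub>0 (snd p))))"
  have [measurable]: "?u r \<in> borel_measurable noise" for r by (rule A_total_noise_measurable)
  note [measurable] = noise_measurable
  interpret N: prob_space "density lborel std_normal_density"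
    by (rule prob_space_normal_density) simp
  have K: "A_const \<gamma> * P \<ge> 0" using pos A_const_nonneg by simp
  have bound: "?u r p \<le> ?w p" if "0 \<le> r" "r \<le> 1" for r p
  proof -
    let ?b = "\<sigma> * (r * fst p)"
    have b: "exp ?b \<le> exp (\<sigma> * fst p) + exp (- \<sigma> * fst p)"
    proof (cases "fst p \<ge> 0")
      case True
      then have "?b \<le> \<sigma> * fst p" using that pos by (simp add: mult_left_le_one_le)
      then have "exp ?b \<le> exp (\<sigma> * fst p)" by simp
      then show ?thesis using exp_ge_zero[of "- \<sigma> * fst p"] by linarith
    next
      case False
      then have "?b \<le> 0" using that pos by (simp add: mult_nonneg_nonpos)
      also have "0 \<le> - \<sigma> * fst p" using False pos by (simp add: mult_nonneg_nonpos)
      finally have "exp ?b \<le> exp (- \<sigma> * fst p)" by simp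
      then show ?thesis using exp_ge_zero[of "\<sigma> * fst p"] by linarith
    qed
    have "A_total \<gamma> xs ys (P * exp ?b) (z\<^sub>0 (snd p) + ?b)
        \<le> A_const \<gamma> * (P * exp ?b + P * exp ?b * exp (- (z\<^sub>0 (snd p) + ?b)))"
      using pos by (intro A_total_le) auto
    \<comment> \<open>The Brownian term cancels: before the first arrival the pool price is still
      the initial one.\<close>
    also have "P * exp ?b * exp (- (z\<^sub>0 (snd p) + ?b)) = P * exp (- z\<^sub>0 (snd p))"
      by (simp flip: exp_add add: mult.assoc)
    also have "A_const \<gamma> * (P * exp ?b + P * exp (- z\<^sub>0 (snd p)))
        = A_const \<gamma> * P * (exp ?b + exp (- z\<^sub>0 (snd p)))"
      by (simp add: algebra_simps)
    also have "\<dots> \<le> A_const \<gamma> * P * ((exp (\<sigma> * fst p) + exp (- \<sigma> * fst p)) + exp (- z\<^sub>0 (snd p)))"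
      using K b by (intro mult_left_mono add_right_mono)
    finally have "?u r p \<le> ennreal (A_const \<gamma> * P * ((exp (\<sigma> * fst p) + exp (- \<sigma> * fst p)) + exp (- z\<^sub>0 (snd p))))"
      by (rule ennreal_leI)
    also have "\<dots> = ?w p" using K by (simp add: ennreal_mult'[OF K])
    finally show ?thesis .
  qed
  have "(\<integral>\<^sup>+\<omega>. ennreal (exp (- z\<^sub>0 \<omega>)) \<partial>M) < \<infinity>"
    using nn_integral_invariant_density_exp[OF pos(1-3) prob_space_invariant_density k]
    by (subst nn_integral_z\<^sub>0[of "\<lambda>x. ennreal (exp (- x))"]) auto
  then have fin: "(\<integral>\<^sup>+p. ?w p \<partial>noise) < \<infinity>"
  proof -
    assume fin: "(\<integral>\<^sup>+\<omega>. ennreal (exp (- z\<^sub>0 \<omega>)) \<partial>M) < \<infinity>"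
    have "(\<integral>\<^sup>+p. ennreal (exp (a * fst p)) \<partial>noise) = ennreal (exp (a\<^sup>2 / 2))" for a
      by (subst nn_integral_noise) (simp_all add: emeasure_space_1 nn_integral_std_normal_exp)
    from this[of \<sigma>] this[of "- \<sigma>"]
    have "(\<integral>\<^sup>+p. ennreal (exp (\<sigma> * fst p)) \<partial>noise) < \<infinity>"
      "(\<integral>\<^sup>+p. ennreal (exp (- \<sigma> * fst p)) \<partial>noise) < \<infinity>" by simp_all
    moreover have "(\<integral>\<^sup>+p. ennreal (exp (- z\<^sub>0 (snd p))) \<partial>noise) < \<infinity>"
      using fin N.emeasure_space_1 by (subst nn_integral_noise) simp_all
    moreover have "(\<integral>\<^sup>+p. ?w p \<partial>noise) = ennreal (A_const \<gamma> * P) *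
      (((\<integral>\<^sup>+p. ennreal (exp (\<sigma> * fst p)) \<partial>noise) + (\<integral>\<^sup>+p. ennreal (exp (- \<sigma> * fst p)) \<partial>noise))
        + (\<integral>\<^sup>+p. ennreal (exp (- z\<^sub>0 (snd p))) \<partial>noise))"
      by (subst nn_integral_cmult, measurable) (subst nn_integral_add, measurable)+
    ultimately show ?thesis
      by (simp add: ennreal_mult_less_top)
  qed
  have "(mean_gain \<longlongrightarrow> mean_gain 0) (at 0 within {0..1})"
    unfolding tendsto_at_iff_sequentially
  proof (intro allI impI)
    fix X :: "nat \<Rightarrow> real"
    assume X: "\<forall>i. X i \<in> {0..1} - {0}" "X \<longlonglongrightarrow> 0"
    have "(\<lambda>i. \<integral>\<^sup>+p. ?u (sqrt (X i)) p \<partial>noise) \<longlonglongrightarrow> (\<integral>\<^sup>+p. ?u 0 p \<partial>noise)"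
    proof (rule nn_integral_dominated_convergence[where w = ?w])
      show "AE p in noise. ?u (sqrt (X i)) p \<le> ?w p" for i
        using X(1) by (intro AE_I2 bound) (auto simp: real_sqrt_le_1_iff)
      show "AE p in noise. (\<lambda>i. ?u (sqrt (X i)) p) \<longlonglongrightarrow> ?u 0 p"
      proof (rule AE_I2)
        fix p
        have "continuous_on UNIV (\<lambda>r. A_total \<gamma> xs ys (P * exp (\<sigma> * (r * fst p))) (z\<^sub>0 (snd p) + \<sigma> * (r * fst p)))"
          by (intro continuous_on_A_total pos continuous_intros)
        moreover have "(\<lambda>i. sqrt (X i)) \<longlonglongrightarrow> 0"
          using tendsto_real_sqrt[OF X(2)] by simp
        ultimately show "(\<lambda>i. ?u (sqrt (X i)) p) \<longlonglongrightarrow> ?u 0 p"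
          by (intro tendsto_ennrealI continuous_on_tendsto_compose[where s = UNIV and l = 0
                and f = "\<lambda>r. A_total \<gamma> xs ys (P * exp (\<sigma> * (r * fst p))) (z\<^sub>0 (snd p) + \<sigma> * (r * fst p))"]) auto
      qed
    qed (use fin in measurable)
    then show "(mean_gain \<circ> X) \<longlonglongrightarrow> mean_gain 0"
      using X(1) by (simp add: o_def mean_gain_eq)
  qed
  then show ?thesis by (simp add: at_within_Icc_at_right)
qed

section \<open>Short-time limit of the expected profit\<close>

lemma nn_integral_ARB:
  assumes "0 \<le> T" "T \<le> 1" "lam * T \<le> 1 / 2"
  obtains R where "R \<le> ennreal (2 * tail_const * (lam * T)\<^sup>2)"
    and "(\<integral>\<^sup>+\<omega>. ennreal (ARB \<sigma> \<gamma> xs ys P B \<tau> z T \<omega>) \<partial>M)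
      = (\<integral>\<^sup>+\<omega>. mean_gain (\<tau> (Suc 0) \<omega>) * indicator {..T} (\<tau> (Suc 0) \<omega>) \<partial>M) + R"
proof
  let ?g = "\<lambda>i \<omega>. ennreal (gain i \<omega>) * indicator {..T} (\<tau> (Suc i) \<omega>)"
  let ?R = "\<Sum>i. \<integral>\<^sup>+\<omega>. ?g (Suc i) \<omega> \<partial>M"
  show "?R \<le> ennreal (2 * tail_const * (lam * T)\<^sup>2)" by (rule suminf_gain_Suc_le[OF assms])
  have "AE \<omega> in M. \<exists>n. T < \<tau> n \<omega>"
    using assms by (intro AE_finitely_many_arrivals) auto
  then have "AE \<omega> in M. ennreal (ARB \<sigma> \<gamma> xs ys P B \<tau> z T \<omega>) = (\<Sum>i. ?g i \<omega>)"
    using AE_space by eventually_elim (use assms in \<open>auto intro: ARB_eq_suminf\<close>)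
  then have "(\<integral>\<^sup>+\<omega>. ennreal (ARB \<sigma> \<gamma> xs ys P B \<tau> z T \<omega>) \<partial>M) = (\<integral>\<^sup>+\<omega>. (\<Sum>i. ?g i \<omega>) \<partial>M)"
    by (rule nn_integral_cong_AE)
  also have "\<dots> = (\<Sum>i. \<integral>\<^sup>+\<omega>. ?g i \<omega> \<partial>M)"
    by (rule nn_integral_suminf) measurable
  also have "\<dots> = ?R + (\<integral>\<^sup>+\<omega>. ?g 0 \<omega> \<partial>M)"
    by (rule sums_unique[symmetric], rule sums_Suc[where f = "\<lambda>i. \<integral>\<^sup>+\<omega>. ?g i \<omega> \<partial>M"], rule summable_sums)
      simp
  finally show "(\<integral>\<^sup>+\<omega>. ennreal (ARB \<sigma> \<gamma> xs ys P B \<tau> z T \<omega>) \<partial>M)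
      = (\<integral>\<^sup>+\<omega>. mean_gain (\<tau> (Suc 0) \<omega>) * indicator {..T} (\<tau> (Suc 0) \<omega>) \<partial>M) + ?R"
    by (simp only: nn_integral_gain_0 add.commute)
qed

lemma prob_\<tau>_1:
  assumes "T \<ge> 0"
  shows "prob {\<omega> \<in> space M. \<tau> (Suc 0) \<omega> \<le> T} = 1 - exp (- T * lam)"
proof -
  have "{\<omega> \<in> space M. \<tau> (Suc 0) \<omega> \<le> T} = {\<omega> \<in> space M. \<tau> (Suc 0) \<omega> - \<tau> 0 \<omega> \<le> T}"
    using \<tau>_0 by auto
  then show ?thesis
    using exponential_distributedD_le[OF waiting_distributed[of 0] assms pos(3)] by simp
qed

text \<open>On the event that the first arrival occurs by \<open>T\<close>, \<open>mean_gain\<close>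
  is within \<open>e\<close> of \<open>m\<close>; the event has probability
  \<open>1 - exp (- T * lam)\<close>, and the later arrivals add the quadratic term. This also
  brings the expectation back from \<open>ennreal\<close> to a real integral.\<close>

lemma integral_ARB_approx:
  assumes "0 \<le> T" "T \<le> 1" "lam * T \<le> 1 / 2" "m \<ge> 0"
    and near: "\<And>t. 0 < t \<Longrightarrow> t \<le> T \<Longrightarrow> ennreal (m - e) \<le> mean_gain t \<and> mean_gain t \<le> ennreal (m + e)"
    and e: "e \<ge> 0"
  shows "\<bar>integral\<^sup>L M (ARB \<sigma> \<gamma> xs ys P B \<tau> z T) - m * (1 - exp (- T * lam))\<bar>
    \<le> e * (1 - exp (- T * lam)) + 2 * tail_const * (lam * T)\<^sup>2"
proof -
  let ?p = "1 - exp (- T * lam)"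
  let ?I = "\<integral>\<^sup>+\<omega>. mean_gain (\<tau> (Suc 0) \<omega>) * indicator {..T} (\<tau> (Suc 0) \<omega>) \<partial>M"
  let ?E = "integral\<^sup>L M (ARB \<sigma> \<gamma> xs ys P B \<tau> z T)"
  obtain R where R: "R \<le> ennreal (2 * tail_const * (lam * T)\<^sup>2)"
    "(\<integral>\<^sup>+\<omega>. ennreal (ARB \<sigma> \<gamma> xs ys P B \<tau> z T \<omega>) \<partial>M) = ?I + R"
    by (rule nn_integral_ARB[OF assms(1-3)])
  have p: "?p \<ge> 0" using assms pos by simp
  have const: "(\<integral>\<^sup>+\<omega>. ennreal c * indicator {\<omega> \<in> space M. \<tau> (Suc 0) \<omega> \<le> T} \<omega> \<partial>M) = ennreal (c * ?p)" for c
    using p prob_\<tau>_1[OF assms(1)]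
    by (simp add: nn_integral_cmult emeasure_eq_measure ennreal_mult'')
  have pt: "ennreal (m - e) * indicator {\<omega> \<in> space M. \<tau> (Suc 0) \<omega> \<le> T} \<omega>
      \<le> mean_gain (\<tau> (Suc 0) \<omega>) * indicator {..T} (\<tau> (Suc 0) \<omega>)"
    "mean_gain (\<tau> (Suc 0) \<omega>) * indicator {..T} (\<tau> (Suc 0) \<omega>)
      \<le> ennreal (m + e) * indicator {\<omega> \<in> space M. \<tau> (Suc 0) \<omega> \<le> T} \<omega>" if "\<omega> \<in> space M" for \<omega>
    using near[of "\<tau> (Suc 0) \<omega>"] that \<tau>_less_iff[OF that, of 0 "Suc 0"] \<tau>_0[OF that]
    by (auto simp: indicator_def)
  have "ennreal ((m - e) * ?p) \<le> ?I" "?I \<le> ennreal ((m + e) * ?p)"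
    using pt unfolding const[symmetric] by (auto intro!: nn_integral_mono)
  then have lo: "ennreal ((m - e) * ?p) \<le> ?I + R"
    and hi: "?I + R \<le> ennreal ((m + e) * ?p + 2 * tail_const * (lam * T)\<^sup>2)"
    using R(1) assms(4) e p tail_const_nonneg
    by (auto simp: ennreal_plus intro: add_mono add_increasing2)
  have E: "?E = enn2real (?I + R)"
    unfolding R(2)[symmetric] by (intro integral_eq_nn_integral AE_I2 ARB_nonneg) measurable
  have "?E \<le> (m + e) * ?p + 2 * tail_const * (lam * T)\<^sup>2"
    unfolding E using hi assms(4) e p tail_const_nonneg by (intro enn2real_leI) auto
  moreover have "(m - e) * ?p \<le> ?E"
  proof -
    have "ennreal ((m - e) * ?p) \<le> ennreal ?E"
      using lo hi unfolding E by (subst ennreal_enn2real) (auto simp: less_top[symmetric] top_unique)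
    \<comment> \<open>A negative lower bound is truncated to 0 by \<open>ennreal\<close>; the real
      inequality survives because \<open>?E\<close> is nonnegative.\<close>
    then show ?thesis
      using E by (simp add: ennreal_le_iff2)
        (use enn2real_nonneg[of "?I + R"] in linarith)
  qed
  ultimately show ?thesis
    using tail_const_nonneg by (simp add: abs_le_iff algebra_simps)
      (smt (verit) mult_nonneg_nonneg zero_le_power2)
qed

text \<open>The probability of an arrival by \<open>T\<close>, divided by \<open>T\<close>, tends to
  \<open>lam\<close>, so the limit defining the rate exists and has the stated value.\<close>

lemma ARB_rate_eq:
  assumes k: "sqrt (2 * lam) / \<sigma> > 1" and m: "mean_gain 0 = ennreal m" "m \<ge> 0"
  shows "ARB_rate M \<sigma> \<gamma> xs ys P B \<tau> z = lam * m"
proof -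
  let ?E = "\<lambda>T. integral\<^sup>L M (ARB \<sigma> \<gamma> xs ys P B \<tau> z T)" and ?p = "\<lambda>T. 1 - exp (- T * lam)"
  have "((\<lambda>T. (?E T - m * ?p T) / T) \<longlongrightarrow> 0) (at_right 0)"
  proof (rule tendstoI)
    fix d :: real assume d: "d > 0"
    \<comment> \<open>The arrival probability is at most \<open>lam * T\<close>, so this choice
      spends half of \<open>d\<close>; the quadratic term spends the other half.\<close>
    define e where "e = d / (2 * lam)"
    have e: "e > 0" using d pos by (simp add: e_def)
    have "eventually (\<lambda>t. ennreal (m - e) \<le> mean_gain t \<and> mean_gain t \<le> ennreal (m + e)) (at_right 0)"
    proof -
      have "ennreal m < ennreal (m + e)" using e m by (simp add: ennreal_less_iff)
      then have 1: "eventually (\<lambda>t. mean_gain t < ennreal (m + e)) (at_right 0)"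
        using mean_gain_tendsto[OF k] unfolding m(1) by (intro order_tendstoD(2))
      have 2: "eventually (\<lambda>t. ennreal (m - e) \<le> mean_gain t) (at_right 0)"
      proof (cases "m - e < 0")
        case True
        then show ?thesis by (simp add: ennreal_neg)
      next
        case False
        then have "ennreal (m - e) < ennreal m" using e by (simp add: ennreal_less_iff)
        then have "eventually (\<lambda>t. ennreal (m - e) < mean_gain t) (at_right 0)"
          using mean_gain_tendsto[OF k] unfolding m(1) by (intro order_tendstoD(1))
        then show ?thesis by eventually_elim simp
      qed
      from 1 2 show ?thesis by eventually_elim auto
    qed
    then obtain b where b: "b > 0"
      "\<And>t. 0 < t \<Longrightarrow> t < b \<Longrightarrow> ennreal (m - e) \<le> mean_gain t \<and> mean_gain t \<le> ennreal (m + e)"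
      by (auto simp: eventually_at_right_field)
    have "((\<lambda>T. 2 * tail_const * lam\<^sup>2 * T) \<longlongrightarrow> 2 * tail_const * lam\<^sup>2 * 0) (at_right 0)"
      by (intro tendsto_intros)
    then have "eventually (\<lambda>T. 2 * tail_const * lam\<^sup>2 * T < d / 2) (at_right 0)"
      using d by (intro order_tendstoD(2)) auto
    moreover have "eventually (\<lambda>T. 0 < T \<and> T < Min {b, 1, 1 / (2 * lam)}) (at_right 0)"
      using b(1) pos eventually_at_right_real[of 0 "Min {b, 1, 1 / (2 * lam)}"] by auto
    ultimately show "eventually (\<lambda>T. dist ((?E T - m * ?p T) / T) 0 < d) (at_right 0)"
    proof eventually_elim
      case (elim T)
      then have T: "0 < T" "T < b" "T < 1" "T < 1 / (2 * lam)" by auto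
      have lT: "lam * T \<le> 1 / 2" using T(4) pos by (simp add: field_simps)
      have "\<bar>?E T - m * ?p T\<bar> \<le> e * ?p T + 2 * tail_const * (lam * T)\<^sup>2"
        using T lT m(2) e b(2) by (intro integral_ARB_approx) auto
      also have "\<dots> \<le> e * (lam * T) + 2 * tail_const * (lam * T)\<^sup>2"
        using exp_ge_add_one_self[of "- T * lam"] e by (simp add: mult.commute)
      also have "\<dots> = (d / 2 + 2 * tail_const * lam\<^sup>2 * T) * T"
        using pos by (simp add: e_def power2_eq_square algebra_simps)
      also have "\<dots> < (d / 2 + d / 2) * T"
        using elim T by (intro mult_strict_right_mono) auto
      finally show ?case using T by (simp add: dist_real_def abs_divide divide_less_eq)
    qed
  qed
  moreover have "((\<lambda>T. m * (?p T / T)) \<longlongrightarrow> m * lam) (at_right 0)"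
  proof (rule tendsto_mult[OF tendsto_const])
    show "((\<lambda>T. ?p T / T) \<longlongrightarrow> lam) (at_right 0)" by real_asymp
  qed
  ultimately have "((\<lambda>T. (?E T - m * ?p T) / T + m * (?p T / T)) \<longlongrightarrow> 0 + m * lam) (at_right 0)"
    by (rule tendsto_add)
  then have "((\<lambda>T. ?E T / T) \<longlongrightarrow> lam * m) (at_right 0)"
    by (simp only: times_divide_eq_right add_divide_distrib[symmetric] diff_add_cancel add_0 mult.commute)
  then show ?thesis
    unfolding ARB_rate_def by (intro tendsto_Lim) auto
qed

text \<open>At time 0 the Brownian value vanishes, so \<open>mean_gain 0\<close> is the mean of the
  profit under \<pi>.\<close>

lemma ARB_rate_eq_laplace:
  assumes k: "sqrt (2 * lam) / \<sigma> \<ge> 2"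
  shows "ARB_rate M \<sigma> \<gamma> xs ys P B \<tau> z = lam * (P_trade \<sigma> \<gamma> lam *
    (\<integral>x. exponential_density (sqrt (2 * lam) / \<sigma>) x * A_bar \<gamma> xs ys P x \<partial>lborel))"
proof (rule ARB_rate_eq)
  have meas: "(\<lambda>x. ennreal (A_total \<gamma> xs ys P x)) \<in> borel_measurable borel"
    by (rule measurable_compose[OF A_total_measurable_mispricing[OF pos(4)] measurable_ennreal])
  have "mean_gain 0 = (\<integral>\<^sup>+\<omega>'. \<integral>\<^sup>+\<omega>. ennreal (A_total \<gamma> xs ys P (z\<^sub>0 \<omega>)) \<partial>M \<partial>M)"
    unfolding mean_gain_def by (intro nn_integral_cong) (simp add: B_0)
  also have "\<dots> = (\<integral>\<^sup>+\<omega>. ennreal (A_total \<gamma> xs ys P (z\<^sub>0 \<omega>)) \<partial>M)"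
    by (simp add: emeasure_space_1)
  also have "\<dots> = ennreal (P_trade \<sigma> \<gamma> lam *
    (\<integral>x. exponential_density (sqrt (2 * lam) / \<sigma>) x * A_bar \<gamma> xs ys P x \<partial>lborel))"
    using nn_integral_invariant_density_A_total[OF pos k] nn_integral_z\<^sub>0[OF meas] by simp
  finally show "mean_gain 0 = ennreal (P_trade \<sigma> \<gamma> lam *
    (\<integral>x. exponential_density (sqrt (2 * lam) / \<sigma>) x * A_bar \<gamma> xs ys P x \<partial>lborel))" .
  show "P_trade \<sigma> \<gamma> lam *
    (\<integral>x. exponential_density (sqrt (2 * lam) / \<sigma>) x * A_bar \<gamma> xs ys P x \<partial>lborel) \<ge> 0"
    using P_trade_pos[OF pos(1-3)] k A_nonneg(4)[OF pos(4)]
    by (intro mult_nonneg_nonneg Bochner_Integration.integral_nonneg erlang_density_nonneg) auto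
qed (use k in simp)

end

theorem theorem3:
  fixes \<sigma> \<gamma> P L :: real
    and f :: "real \<times> real \<Rightarrow> real"
    and xs ys :: "real \<Rightarrow> real"
    and M :: "real \<Rightarrow> 'a measure"
    and B :: "real \<Rightarrow> real \<Rightarrow> 'a \<Rightarrow> real"
    and \<tau> :: "real \<Rightarrow> nat \<Rightarrow> 'a \<Rightarrow> real"
    and z\<^sub>0 :: "real \<Rightarrow> 'a \<Rightarrow> real"
    and z :: "real \<Rightarrow> real \<Rightarrow> 'a \<Rightarrow> real"
  assumes "\<sigma> > 0" and "\<gamma> > 0" and "P > 0"
    and "\<And>lam. lam > 0 \<Longrightarrow>
           mispricing_model (M lam) \<sigma> \<gamma> lam (B lam) (\<tau> lam) (z\<^sub>0 lam) (z lam)"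
    and "\<And>p. p \<ge> 0 \<Longrightarrow> optimal_reserves f L p (xs p, ys p)"
    and "\<exists>V1 V2. C2_derivs {0<..} (pool_value f L) V1 V2"
    and "\<And>lam t. lam > 0 \<Longrightarrow> t \<ge> 0 \<Longrightarrow>
           (\<integral>\<^sup>+\<omega>. (\<integral>\<^sup>+s\<in>{0..t}.
              ennreal ((xs (price \<sigma> P (B lam) s \<omega>))\<^sup>2 * (price \<sigma> P (B lam) s \<omega>)\<^sup>2)
              \<partial>lborel) \<partial>M lam) < \<infinity>"
    and "\<And>p. p > 0 \<Longrightarrow>
           \<exists>D1 D2. C2_derivs {0..} (A_bar \<gamma> xs ys p) D1 D2 \<and>
             (\<exists>A\<^sub>0 c. \<forall>x\<ge>0. D2 x \<le> A\<^sub>0 * exp (c * x))"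
  shows "(\<forall>p>0. \<forall>x\<ge>0. A_bar \<gamma> xs ys p x \<ge> 0) \<and>
         (\<lambda>lam. ARB_rate (M lam) \<sigma> \<gamma> xs ys P (B lam) (\<tau> lam) (z lam)
             - \<sigma>\<^sup>2 * P / 2
               * ((deriv ys (P * exp (- \<gamma>)) + exp \<gamma> * deriv ys (P * exp \<gamma>)) / 2)
               * P_trade \<sigma> \<gamma> lam)
           \<in> o[at_top](\<lambda>lam. sqrt (inverse lam))"
proof (intro conjI allI impI)
  obtain V1 V2 where "C2_derivs {0<..} (pool_value f L) V1 V2" using assms(6) by blast
  then interpret pool: smooth_pool f L xs ys V1 V2
    using assms(5) by unfold_locales
  show "A_bar \<gamma> xs ys p x \<ge> 0" if "p > 0" for p x
    by (rule pool.A_nonneg(4)[OF that])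
  let ?g = "A_bar \<gamma> xs ys P" and ?D = "pool.A_curv \<gamma> P"
  define k where "k lam = sqrt (2 * lam) / \<sigma>" for lam
  define J where "J k = k\<^sup>2 * (\<integral>x. exponential_density k x * ?g x \<partial>lborel)" for k
  have k_lim: "filterlim k at_top at_top"
    unfolding k_def using assms(1) by real_asymp
  obtain C where C: "\<And>x. x \<ge> 0 \<Longrightarrow> ?g x \<le> C * x\<^sup>2 * exp x"
    using pool.A_bar_le_square_exp[OF assms(3) less_imp_le[OF assms(2)]] by blast
  have "(J \<longlongrightarrow> ?D) at_top"
    unfolding J_def
    by (rule laplace_quadratic(2)[OF pool.A_bar_measurable[OF assms(3)] pool.A_nonneg(4)[OF assms(3)]
        C pool.A_bar_over_square[OF assms(3)]])
  then have J_lim: "((\<lambda>lam. J (k lam) - ?D) \<longlongrightarrow> 0) at_top"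
    using filterlim_compose[OF _ k_lim] Lim_null by blast
  let ?err = "\<lambda>lam. ARB_rate (M lam) \<sigma> \<gamma> xs ys P (B lam) (\<tau> lam) (z lam)
    - \<sigma>\<^sup>2 * P / 2 * ((deriv ys (P * exp (- \<gamma>)) + exp \<gamma> * deriv ys (P * exp \<gamma>)) / 2) * P_trade \<sigma> \<gamma> lam"
  \<comment> \<open>The whole error is \<open>P_trade\<close> times the deviation of the Laplace
    factor from its limit.\<close>
  have err: "?err lam = \<sigma>\<^sup>2 / 2 * P_trade \<sigma> \<gamma> lam * (J (k lam) - ?D)"
    if lam: "lam > 0" and k2: "k lam \<ge> 2" for lam
  proof -
    interpret m: mispricing_model "M lam" \<sigma> \<gamma> lam "B lam" "\<tau> lam" "z\<^sub>0 lam" "z lam"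
      using assms(4)[OF lam] .
    interpret m: arbitrage_model "M lam" \<sigma> \<gamma> lam "B lam" "\<tau> lam" "z\<^sub>0 lam" "z lam" f L xs ys V1 V2 P
      using assms(1-3) lam by unfold_locales
    let ?I = "\<integral>x. exponential_density (k lam) x * ?g x \<partial>lborel"
    have "(k lam)\<^sup>2 = 2 * lam / \<sigma>\<^sup>2" using lam by (simp add: k_def power_divide)
    then have "lam * ?I = \<sigma>\<^sup>2 / 2 * J (k lam)"
      using assms(1) by (simp add: J_def)
    moreover have "ARB_rate (M lam) \<sigma> \<gamma> xs ys P (B lam) (\<tau> lam) (z lam)
        = P_trade \<sigma> \<gamma> lam * (lam * ?I)"
      using m.ARB_rate_eq_laplace k2 by (simp add: k_def)
    ultimately show ?thesis
      by (simp add: pool.A_curv_def algebra_simps)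
  qed
  \<comment> \<open>\<open>P_trade\<close> already has the order of the comparison function, and the
    vanishing deviation turns big O into small o.\<close>
  have small: "(\<lambda>lam. \<sigma>\<^sup>2 / 2 * P_trade \<sigma> \<gamma> lam * (J (k lam) - ?D)) \<in> o[at_top](\<lambda>lam. sqrt (inverse lam) * 1)"
  proof (rule landau_o.big_small_mult)
    show "(\<lambda>lam. \<sigma>\<^sup>2 / 2 * P_trade \<sigma> \<gamma> lam) \<in> O[at_top](\<lambda>lam. sqrt (inverse lam))"
      unfolding P_trade_def using assms(1,2) by real_asymp
    show "(\<lambda>lam. J (k lam) - ?D) \<in> o[at_top](\<lambda>_. 1)"
      using J_lim by (intro smalloI_tendsto) auto
  qed
  have ev: "eventually (\<lambda>lam. \<sigma>\<^sup>2 / 2 * P_trade \<sigma> \<gamma> lam * (J (k lam) - ?D) = ?err lam) at_top"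
    using eventually_gt_at_top[of 0] filterlim_at_top[THEN iffD1, OF k_lim, rule_format, of 2]
    by eventually_elim (simp only: err)
  show "?err \<in> o[at_top](\<lambda>lam. sqrt (inverse lam))"
    using small landau_o.small.in_cong[OF ev] by simp
qed

end
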